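(* Let $M=\{0,1\}^{\mathbb{Z}}$ with the metric $d(x,y)=2^{-N(x,y)}$, where $N(x,y)=\sup\{N\ge 0: x_n=y_n \text{ for all } |n|<N\}$, and let $f:M\to M$ be the left shift $f((x_n)_{n})=(x_{n+1})_{n}$. Fix $p\in(0,1)$ and let $\mu_p=\nu_p^{\mathbb{Z}}$ be the Bernoulli product measure on $M$, where $\nu_p=p\delta_1+(1-p)\delta_0$. Let $\alpha>0$ and let $\eta,\sigma$ be real numbers with $1<\eta<\sigma$, such that $$2^{3\alpha}<\eta^2 \quad\text{and}\quad \frac{p}{1-p}\neq\frac{\log\eta}{\log\sigma}.$$ Define $A_{\sigma\eta}:M\to \mathrm{SL}(2,\mathbb{R})$ by $$A_{\sigma\eta}(x)=\begin{pmatrix}\eta^{-1}&0\\0&\eta\end{pmatrix}\text{ if }x_0=0,\qquad A_{\sigma\eta}(x)=\begin{pmatrix}\sigma&0\\0&\sigma^{-1}\end{pmatrix}\text{ if }x_0=1.$$ Then for every $\varepsilon>0$ there exists an $\alpha$-Hölder continuous map $B:M\to\mathrm{SL}(2,\mathbb{R})$ with $\|B-A_{\sigma\eta}\|_\alpha<\varepsilon$ and $\lambda_+(B,\mu_p)=\lambda_-(B,\mu_p)=0$. Consequently (since $\lambda_{\pm}(A_{\sigma\eta},\mu_p)=\pm|(1-p)\log\eta-p\log\sigma|\neq 0$), $A_{\sigma\eta}$ is a discontinuity point of the Lyapunov exponents (with respect to $\mu_p$) as functions on $C^{\alpha}(M,\mathrm{SL}(2,\mathbb{R}))$.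
   Context: A continuous map $A:M\to\mathrm{SL}(2,\mathbb{R})$ defines the linear cocycle $F_A(x,v)=(f(x),A(x)v)$ over $f$, with iterates $A^n(x)=A(f^{n-1}(x))\cdots A(x)$ for $n>0$. Its extremal Lyapunov exponents with respect to the ergodic $f$-invariant measure $\mu_p$ are the $\mu_p$-a.e. constant limits $\lambda_+(A,\mu_p)=\lim_{n\to\infty}\frac1n\log\|A^n(x)\|$ and $\lambda_-(A,\mu_p)=\lim_{n\to\infty}\frac1n\log\|A^n(x)^{-1}\|^{-1}$ (Euclidean norm and associated operator norm). $C^{\alpha}(M,\mathrm{SL}(2,\mathbb{R}))$ is the space of $\alpha$-Hölder continuous maps $A:M\to\mathrm{SL}(2,\mathbb{R})$ with the norm $\|A\|_\alpha=\sup_{x\in M}\|A(x)\|+\sup_{x\neq y}\frac{\|A(x)-A(y)\|}{d(x,y)^\alpha}$. *)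

theory Defs
  imports "HOL-Probability.Probability" "HOL-Analysis.Analysis"
begin

text \<open>Points of M = {0,1}^Z are modelled as int \<Rightarrow> bool (True = 1, False = 0).\<close>

type_synonym seq = "int \<Rightarrow> bool"
type_synonym mat2 = "real^2^2"

definition agree_len :: "seq \<Rightarrow> seq \<Rightarrow> nat" where
  "agree_len x y = Sup {N::nat. \<forall>n::int. \<bar>n\<bar> < int N \<longrightarrow> x n = y n}"

definition shift_dist :: "seq \<Rightarrow> seq \<Rightarrow> real" where
  "shift_dist x y = (if x = y then 0 else 2 powr (- real (agree_len x y)))"

definition shift :: "seq \<Rightarrow> seq" where
  "shift x = (\<lambda>n. x (n + 1))"

definition bernoulli_shift_measure :: "real \<Rightarrow> seq measure" where
  "bernoulli_shift_measure p = PiM UNIV (\<lambda>_::int. measure_pmf (bernoulli_pmf p))"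

definition opnorm :: "mat2 \<Rightarrow> real" where
  "opnorm A = onorm (\<lambda>v. A *v v)"

definition is_SL2 :: "mat2 \<Rightarrow> bool" where
  "is_SL2 A \<longleftrightarrow> det A = 1"

definition holder_map :: "real \<Rightarrow> (seq \<Rightarrow> mat2) \<Rightarrow> bool" where
  "holder_map \<alpha> A \<longleftrightarrow> (\<exists>C. \<forall>x y. opnorm (A x - A y) \<le> C * shift_dist x y powr \<alpha>)"

definition holder_norm :: "real \<Rightarrow> (seq \<Rightarrow> mat2) \<Rightarrow> real" where
  "holder_norm \<alpha> A = (SUP x. opnorm (A x)) +
     (SUP xy \<in> {(x, y). x \<noteq> y}. opnorm (A (fst xy) - A (snd xy)) / shift_dist (fst xy) (snd xy) powr \<alpha>)"

fun cocycle :: "(seq \<Rightarrow> mat2) \<Rightarrow> nat \<Rightarrow> seq \<Rightarrow> mat2" where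
  "cocycle A 0 x = mat 1"
| "cocycle A (Suc n) x = A ((shift ^^ n) x) ** cocycle A n x"

definition lyap_plus_is :: "seq measure \<Rightarrow> (seq \<Rightarrow> mat2) \<Rightarrow> real \<Rightarrow> bool" where
  "lyap_plus_is \<mu> A L \<longleftrightarrow>
     (AE x in \<mu>. (\<lambda>n. ln (opnorm (cocycle A n x)) / real n) \<longlonglongrightarrow> L)"

definition lyap_minus_is :: "seq measure \<Rightarrow> (seq \<Rightarrow> mat2) \<Rightarrow> real \<Rightarrow> bool" where
  "lyap_minus_is \<mu> A L \<longleftrightarrow>
     (AE x in \<mu>. (\<lambda>n. ln (inverse (opnorm (matrix_inv (cocycle A n x)))) / real n) \<longlonglongrightarrow> L)"

definition A_sigma_eta :: "real \<Rightarrow> real \<Rightarrow> seq \<Rightarrow> mat2" where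
  "A_sigma_eta \<sigma> \<eta> x =
     (if x 0 then (\<chi> i j. if i = j then (if i = 1 then \<sigma> else inverse \<sigma>) else 0)
      else (\<chi> i j. if i = j then (if i = 1 then inverse \<eta> else \<eta>) else 0))"

end

theory Submission
  imports Defs "HOL-Library.Discrete_Functions"
begin

text \<open>
  Fix a large n and look at the occurrences of the word 0...01...1 (n zeros, then n ones); these never
  overlap. Three shears, at the beginning, in the middle and at the end of every occurrence, compose to
  a map exchanging the two coordinate axes, since L(k) U(-1/k) L(k) is antidiagonal for lower and upper
  shears L, U. Hyperbolicity amplifies the outer two shears, so they may have size about
  k eta^(-2n) while the middle one has size 1/k. The middle shear depends on about n and the outer
  ones on about 2n coordinates, so with k slightly larger than 2^(alpha n) the Hoelder norm of the perturbation
  is small precisely because 2^(3 alpha) < eta^2.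

  Up to a bounded conjugacy the perturbed cocycle is monomial, and the logarithm of its entries is a
  sum of the letter contributions with a sign that flips at every occurrence. Exchanging
  the two middle letters of an occurrence preserves the measure and removes exactly one flip,
  so the signed summands have exponentially decaying correlations, and their averages tend to 0.
\<close>

section \<open>A strong law for bounded variables with decaying correlations\<close>

text \<open>Consecutive squares m^2 and (m + 1)^2 differ by O(m), so between them the averages of a
  bounded sequence can change by only O(1/m).\<close>

lemma sum_square_gap:
  fixes a :: "nat \<Rightarrow> real"
  assumes bnd: "\<And>k. \<bar>a k\<bar> \<le> K"
    and lim: "(\<lambda>m. (\<Sum>k<(Suc m)\<^sup>2. a k) / real ((Suc m)\<^sup>2)) \<longlonglongrightarrow> 0"
  shows "(\<lambda>N. (\<Sum>k<N. a k) / real N) \<longlonglongrightarrow> 0"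
proof -
  have K: "0 \<le> K" using bnd[of 0] by linarith
  define u where "u m = \<bar>(\<Sum>k<(Suc m)\<^sup>2. a k) / real ((Suc m)\<^sup>2)\<bar> + 3 * K / real (Suc m)" for m
  have u0: "u \<longlonglongrightarrow> 0"
  proof -
    have "(\<lambda>m. 3 * K / real (Suc m)) \<longlonglongrightarrow> 0"
      by (rule LIMSEQ_Suc, rule lim_const_over_n)
    from tendsto_add[OF tendsto_rabs_zero[OF lim] this] show ?thesis unfolding u_def by simp
  qed
  \<comment> \<open>\<open>u m\<close> refers to the square of \<open>Suc m\<close>, hence the
    \<open>- 1\<close>, which is harmless for N \<ge> 1.\<close>
  define g where "g N = floor_sqrt N - 1" for N
  have g: "filterlim g at_top sequentially"
    unfolding filterlim_at_top
  proof
    fix Z show "\<forall>\<^sub>F N in sequentially. Z \<le> g N"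
      using eventually_ge_at_top[of "(Suc Z)\<^sup>2"]
    proof eventually_elim
      case (elim N)
      hence "Suc Z \<le> floor_sqrt N" by (simp add: le_floor_sqrt_iff)
      thus ?case by (simp add: g_def)
    qed
  qed
  have "\<forall>\<^sub>F N in sequentially. norm ((\<Sum>k<N. a k) / real N) \<le> u (g N)"
    using eventually_ge_at_top[of 1]
  proof eventually_elim
    case (elim N)
    define m where "m = floor_sqrt N"
    have m1: "m \<ge> 1" using elim by (simp add: m_def le_floor_sqrt_iff)
    have mN: "m\<^sup>2 \<le> N" by (simp add: m_def)
    have Nm: "N < (Suc m)\<^sup>2" using Suc_floor_sqrt_power2_gt[of N] by (simp add: m_def)
    have gm: "Suc (g N) = m" using m1 by (simp add: g_def m_def)
    have "(\<Sum>k<N. a k) = (\<Sum>k<m\<^sup>2. a k) + (\<Sum>k\<in>{m\<^sup>2..<N}. a k)"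
      using mN by (metis sum.atLeastLessThan_concat lessThan_atLeast0 zero_le)
    moreover have "\<bar>\<Sum>k\<in>{m\<^sup>2..<N}. a k\<bar> \<le> real (N - m\<^sup>2) * K"
      using sum_bounded_above[of "{m\<^sup>2..<N}" "\<lambda>k. \<bar>a k\<bar>" K] bnd
      by (intro order_trans[OF sum_abs]) simp
    moreover have "real (N - m\<^sup>2) * K \<le> (3 * real m) * K"
    proof (rule mult_right_mono[OF _ K])
      have "N - m\<^sup>2 \<le> 3 * m" using Nm m1 by (simp add: power2_eq_square)
      thus "real (N - m\<^sup>2) \<le> 3 * real m" by linarith
    qed
    ultimately have "\<bar>\<Sum>k<N. a k\<bar> \<le> \<bar>\<Sum>k<m\<^sup>2. a k\<bar> + 3 * m * K" by linarith
    hence "\<bar>\<Sum>k<N. a k\<bar> / N \<le> (\<bar>\<Sum>k<m\<^sup>2. a k\<bar> + 3 * m * K) / N"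
      by (rule divide_right_mono) simp
    also have "\<dots> \<le> (\<bar>\<Sum>k<m\<^sup>2. a k\<bar> + 3 * m * K) / real (m\<^sup>2)"
      using mN m1 K elim by (intro divide_left_mono) (auto simp del: of_nat_power intro!: mult_pos_pos)
    also have "\<dots> = u (g N)"
      using m1 unfolding u_def gm by (simp add: add_divide_distrib power2_eq_square)
    finally show ?case by simp
  qed
  moreover have "(\<lambda>N. u (g N)) \<longlonglongrightarrow> 0" by (rule filterlim_compose[OF u0 g])
  ultimately show ?thesis by (rule Lim_null_comparison)
qed

text \<open>Passing from N to N + 1 adds the square of the new term, at most K^2, and twice its
  correlations with the earlier terms, whose sum is at most C / (1 - r) by the geometric
  series.\<close>

lemma (in prob_space) second_moment_linear:
  fixes Z :: "nat \<Rightarrow> 'a \<Rightarrow> real"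
  assumes meas [measurable]: "\<And>k. random_variable borel (Z k)"
    and bnd: "\<And>k x. \<bar>Z k x\<bar> \<le> K"
    and cor: "\<And>j k. j < k \<Longrightarrow> \<bar>expectation (\<lambda>x. Z j x * Z k x)\<bar> \<le> C * r ^ (k - j)"
    and r: "0 \<le> r" "r < 1" and C: "0 \<le> C"
  shows "expectation (\<lambda>x. (\<Sum>k<N. Z k x)\<^sup>2) \<le> (2 * C / (1 - r) + K\<^sup>2) * real N"
proof (induction N)
  case (Suc N)
  have int: "integrable M (\<lambda>x. Z j x * Z k x)" for j k
    by (rule integrable_const_bound[where B="K * K"])
       (auto simp: abs_mult intro!: AE_I2 mult_mono bnd order_trans[OF abs_ge_zero bnd])
  have intS: "integrable M (\<lambda>x. (\<Sum>k<N. Z k x)\<^sup>2)"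
    unfolding power2_eq_square sum_product by (intro Bochner_Integration.integrable_sum int)
  have "(\<Sum>k<Suc N. Z k x)\<^sup>2 = (\<Sum>k<N. Z k x)\<^sup>2 + 2 * (\<Sum>j<N. Z j x * Z N x) + Z N x * Z N x" for x
    by (simp add: power2_eq_square algebra_simps sum_distrib_left sum_distrib_right)
  hence "expectation (\<lambda>x. (\<Sum>k<Suc N. Z k x)\<^sup>2)
    = expectation (\<lambda>x. (\<Sum>k<N. Z k x)\<^sup>2) + 2 * (\<Sum>j<N. expectation (\<lambda>x. Z j x * Z N x))
      + expectation (\<lambda>x. Z N x * Z N x)"
    using int intS by (simp add: Bochner_Integration.integral_sum)
  moreover have "(\<Sum>j<N. expectation (\<lambda>x. Z j x * Z N x)) \<le> C / (1 - r)"
  proof -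
    have "(\<Sum>j<N. expectation (\<lambda>x. Z j x * Z N x)) \<le> (\<Sum>j<N. C * r ^ (N - j))"
      by (intro sum_mono order_trans[OF abs_ge_self cor]) simp
    \<comment> \<open>Reverses the summation by j -> N - 1 - j; every gap is at least 1, which
      leaves the factor r in front.\<close>
    also have "\<dots> = C * r * (\<Sum>j<N. r ^ j)"
      by (subst sum.nat_diff_reindex[symmetric])
         (auto simp: sum_distrib_left mult.assoc Suc_diff_Suc simp flip: power_Suc intro!: sum.cong)
    also have "\<dots> = C * r * ((1 - r ^ N) / (1 - r))"
      using r by (subst sum_gp_strict) auto
    also have "\<dots> \<le> C * 1 * (1 / (1 - r))"
      using r C by (intro mult_mono divide_right_mono) (auto simp: power_le_one)
    finally show ?thesis by simp
  qed
  moreover have "expectation (\<lambda>x. Z N x * Z N x) \<le> K\<^sup>2"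
  proof -
    have "Z N x * Z N x \<le> K\<^sup>2" for x
      using bnd[of N x] abs_le_square_iff[of "Z N x" K] by (simp add: power2_eq_square)
    hence "expectation (\<lambda>x. Z N x * Z N x) \<le> expectation (\<lambda>x. K\<^sup>2)"
      by (intro integral_mono int) auto
    thus ?thesis by (simp add: prob_space)
  qed
  ultimately have "expectation (\<lambda>x. (\<Sum>k<Suc N. Z k x)\<^sup>2)
      \<le> (2 * C / (1 - r) + K\<^sup>2) * real N + 2 * (C / (1 - r)) + K\<^sup>2"
    using Suc.IH by linarith
  also have "\<dots> = (2 * C / (1 - r) + K\<^sup>2) * real (Suc N)"
    by (simp add: distrib_left distrib_right)
  finally show ?case .
qed simp

text \<open>The squared averages have mean O(1/N), which is summable along N = m^2. Hence their sum
  along the squares is almost surely finite and they tend to 0; \<open>sum_square_gap\<close> fills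
  in the other N.\<close>

theorem (in prob_space) strong_law_decaying_correlations:
  fixes Z :: "nat \<Rightarrow> 'a \<Rightarrow> real"
  assumes meas [measurable]: "\<And>k. random_variable borel (Z k)"
    and bnd: "\<And>k x. \<bar>Z k x\<bar> \<le> K"
    and cor: "\<And>j k. j < k \<Longrightarrow> \<bar>expectation (\<lambda>x. Z j x * Z k x)\<bar> \<le> C * r ^ (k - j)"
    and r: "0 \<le> r" "r < 1" and C: "0 \<le> C"
  shows "AE x in M. (\<lambda>N. (\<Sum>k<N. Z k x) / real N) \<longlonglongrightarrow> 0"
proof -
  define D where "D = 2 * C / (1 - r) + K\<^sup>2"
  have D: "0 \<le> D" unfolding D_def using r C by simp
  define W where "W m x = ((\<Sum>k<(Suc m)\<^sup>2. Z k x) / real ((Suc m)\<^sup>2))\<^sup>2" for m x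
  have [measurable]: "W m \<in> borel_measurable M" for m unfolding W_def by measurable
  have intW: "integrable M (W m)" for m
  proof (rule integrable_const_bound[where B="K\<^sup>2"])
    show "AE x in M. norm (W m x) \<le> K\<^sup>2"
    proof (rule AE_I2)
      fix x
      have "\<bar>\<Sum>k<(Suc m)\<^sup>2. Z k x\<bar> \<le> real ((Suc m)\<^sup>2) * K"
        using sum_bounded_above[of "{..<(Suc m)\<^sup>2}" "\<lambda>k. \<bar>Z k x\<bar>" K] bnd
        by (intro order_trans[OF sum_abs]) simp
      moreover have "\<bar>K\<bar> = K" using bnd[of 0 x] by simp
      ultimately have "\<bar>(\<Sum>k<(Suc m)\<^sup>2. Z k x) / real ((Suc m)\<^sup>2)\<bar> \<le> \<bar>K\<bar>"
        by (simp add: divide_le_eq mult.commute del: of_nat_power of_nat_Suc)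
      thus "norm (W m x) \<le> K\<^sup>2" unfolding W_def by (simp add: abs_le_square_iff[symmetric] del: of_nat_power of_nat_Suc)
    qed
  qed simp
  have EW: "expectation (W m) \<le> D * inverse (real (Suc m))^2" for m
  proof -
    have "expectation (W m) = expectation (\<lambda>x. (\<Sum>k<(Suc m)\<^sup>2. Z k x)\<^sup>2) / (real ((Suc m)\<^sup>2))\<^sup>2"
      unfolding W_def by (simp add: power_divide)
    also have "\<dots> \<le> D * real ((Suc m)\<^sup>2) / (real ((Suc m)\<^sup>2))\<^sup>2"
      unfolding D_def by (intro divide_right_mono second_moment_linear[OF meas bnd cor r C]) auto
    also have "\<dots> = D * inverse (real (Suc m))^2"
      by (simp only: of_nat_power) (simp add: power2_eq_square field_simps del: of_nat_Suc)
    finally show ?thesis .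
  qed
  have sm: "summable (\<lambda>m. D * inverse (real (Suc m))^2)"
    by (intro summable_mult) (use inverse_squares_sums in \<open>simp add: sums_iff add.commute inverse_eq_divide power_divide\<close>)
  \<comment> \<open>In \<open>ennreal\<close>, sum and integral may be exchanged before any
    finiteness is known.\<close>
  have "(\<integral>\<^sup>+x. (\<Sum>m. ennreal (W m x)) \<partial>M) = (\<Sum>m. \<integral>\<^sup>+x. ennreal (W m x) \<partial>M)"
    by (rule nn_integral_suminf) measurable
  also have "\<dots> = (\<Sum>m. ennreal (expectation (W m)))"
    by (intro suminf_cong nn_integral_eq_integral intW AE_I2) (simp add: W_def)
  also have "\<dots> \<le> (\<Sum>m. ennreal (D * inverse (real (Suc m))^2))"
    by (intro suminf_le ennreal_leI EW) auto
  also have "\<dots> = ennreal (\<Sum>m. D * inverse (real (Suc m))^2)"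
    using D by (intro suminf_ennreal2 sm) auto
  finally have "(\<integral>\<^sup>+x. (\<Sum>m. ennreal (W m x)) \<partial>M) \<noteq> \<infinity>" by (auto simp: top_unique)
  hence "AE x in M. (\<Sum>m. ennreal (W m x)) \<noteq> \<infinity>"
    by (intro nn_integral_noteq_infinite) auto
  thus ?thesis
  proof eventually_elim
    case (elim x)
    have "summable (\<lambda>m. W m x)"
      using elim by (intro summable_suminf_not_top) (auto simp: W_def)
    hence "(\<lambda>m. W m x) \<longlonglongrightarrow> 0" by (rule summable_LIMSEQ_zero)
    hence "(\<lambda>m. sqrt (W m x)) \<longlonglongrightarrow> 0" using tendsto_real_sqrt by fastforce
    hence "(\<lambda>m. \<bar>(\<Sum>k<(Suc m)\<^sup>2. Z k x) / real ((Suc m)\<^sup>2)\<bar>) \<longlonglongrightarrow> 0"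
      unfolding W_def by (simp del: of_nat_power of_nat_Suc)
    hence "(\<lambda>m. (\<Sum>k<(Suc m)\<^sup>2. Z k x) / real ((Suc m)\<^sup>2)) \<longlonglongrightarrow> 0"
      by (rule tendsto_rabs_zero_cancel)
    with bnd show ?case by (intro sum_square_gap) auto
  qed
qed

section \<open>Two-by-two matrices and growth of cocycles\<close>

definition mat22 :: "real \<Rightarrow> real \<Rightarrow> real \<Rightarrow> real \<Rightarrow> mat2" where
  "mat22 a b c d = vector [vector [a, b], vector [c, d]]"

lemma mat22_nth [simp]: "mat22 a b c d $ 1 $ 1 = a" "mat22 a b c d $ 1 $ 2 = b"
    "mat22 a b c d $ 2 $ 1 = c" "mat22 a b c d $ 2 $ 2 = d"
  by (simp_all add: mat22_def)

lemma mat2_eq_iff: "(A::mat2) = B \<longleftrightarrow> A$1$1 = B$1$1 \<and> A$1$2 = B$1$2 \<and> A$2$1 = B$2$1 \<and> A$2$2 = B$2$2"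
  by (auto simp: vec_eq_iff forall_2)

lemma mat22_eq [simp]: "mat22 a b c d = mat22 a' b' c' d' \<longleftrightarrow> a = a' \<and> b = b' \<and> c = c' \<and> d = d'"
  by (simp add: mat2_eq_iff)

lemma mat22_cases: obtains a b c d where "A = mat22 a b c d"
  by (metis mat2_eq_iff mat22_nth)

lemma mat22_mult [simp]:
  "mat22 a b c d ** mat22 a' b' c' d' = mat22 (a * a' + b * c') (a * b' + b * d') (c * a' + d * c') (c * b' + d * d')"
  by (simp add: mat2_eq_iff matrix_matrix_mult_def sum_2)

lemma mat22_diff: "mat22 a b c d - mat22 a' b' c' d' = mat22 (a - a') (b - b') (c - c') (d - d')"
  by (simp add: mat2_eq_iff)

lemma mat_1_eq_mat22: "mat 1 = mat22 1 0 0 1"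
  by (simp add: mat2_eq_iff mat_def)

lemma det_mat22 [simp]: "det (mat22 a b c d) = a * d - b * c"
  by (simp add: det_2)

lemma matrix_inv_mat22:
  assumes "a * d - b * c = 1"
  shows "matrix_inv (mat22 a b c d) = mat22 d (- b) (- c) a"
  unfolding matrix_inv_def
proof (rule some_equality)
  show inv: "mat22 a b c d ** mat22 d (- b) (- c) a = mat 1 \<and> mat22 d (- b) (- c) a ** mat22 a b c d = mat 1"
    using assms by (simp add: mat_1_eq_mat22 algebra_simps)
  show "B = mat22 d (- b) (- c) a" if "mat22 a b c d ** B = mat 1 \<and> B ** mat22 a b c d = mat 1" for B
    using that inv by (metis matrix_mul_assoc matrix_mul_lid matrix_mul_rid)
qed

text \<open>Stands in for \<open>opnorm\<close>, to which it is comparable up to a factor 4. Bounded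
  factors do not affect exponents, and this norm is read directly off the entries and is visibly
  unchanged by inversion in SL2.\<close>

definition entry_sum :: "mat2 \<Rightarrow> real" where
  "entry_sum A = \<bar>A$1$1\<bar> + \<bar>A$1$2\<bar> + \<bar>A$2$1\<bar> + \<bar>A$2$2\<bar>"

lemma opnorm_le_entry_sum: "opnorm A \<le> entry_sum A"
  using onorm_le_matrix_component_sum[of A] by (simp add: opnorm_def entry_sum_def sum_2)

lemma entry_sum_le_opnorm: "entry_sum A \<le> 4 * opnorm A"
proof -
  have "\<bar>A $ i $ j\<bar> \<le> opnorm A" for i j
    using matrix_component_le_onorm[of A i j] by (simp add: opnorm_def)
  from this[of 1 1] this[of 1 2] this[of 2 1] this[of 2 2] show ?thesis
    unfolding entry_sum_def by linarith
qed

lemma opnorm_nonneg: "0 \<le> opnorm A"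
  using entry_sum_le_opnorm[of A] by (simp add: entry_sum_def)

lemma entry_sum_mat22: "entry_sum (mat22 a b c d) = \<bar>a\<bar> + \<bar>b\<bar> + \<bar>c\<bar> + \<bar>d\<bar>"
  by (simp add: entry_sum_def)

lemma entry_sum_mult: "entry_sum (A ** B) \<le> entry_sum A * entry_sum B"
proof -
  obtain a b c d where A: "A = mat22 a b c d" by (rule mat22_cases)
  obtain a' b' c' d' where B: "B = mat22 a' b' c' d'" by (rule mat22_cases)
  have nonneg: "(a * a' + b * c') + (a * b' + b * d') + (c * a' + d * c') + (c * b' + d * d')
      \<le> (a + b + c + d) * (a' + b' + c' + d')"
    if "0 \<le> a" "0 \<le> b" "0 \<le> c" "0 \<le> d" "0 \<le> a'" "0 \<le> b'" "0 \<le> c'" "0 \<le> d'"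
    for a b c d a' b' c' d' :: real
  proof -
    have "0 \<le> a * c'" "0 \<le> a * d'" "0 \<le> b * a'" "0 \<le> b * b'"
      "0 \<le> c * c'" "0 \<le> c * d'" "0 \<le> d * a'" "0 \<le> d * b'"
      using that by simp_all
    thus ?thesis unfolding distrib_left distrib_right by linarith
  qed
  have "entry_sum (A ** B) \<le> (\<bar>a\<bar> * \<bar>a'\<bar> + \<bar>b\<bar> * \<bar>c'\<bar>) + (\<bar>a\<bar> * \<bar>b'\<bar> + \<bar>b\<bar> * \<bar>d'\<bar>)
      + (\<bar>c\<bar> * \<bar>a'\<bar> + \<bar>d\<bar> * \<bar>c'\<bar>) + (\<bar>c\<bar> * \<bar>b'\<bar> + \<bar>d\<bar> * \<bar>d'\<bar>)"
    unfolding A B mat22_mult entry_sum_mat22 abs_mult[symmetric] by (intro add_mono abs_triangle_ineq)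
  also have "\<dots> \<le> entry_sum A * entry_sum B"
    unfolding A B entry_sum_mat22 by (intro nonneg abs_ge_zero)
  finally show ?thesis .
qed

lemma entry_sum_matrix_inv:
  assumes "det A = 1" shows "entry_sum (matrix_inv A) = entry_sum A"
proof -
  obtain a b c d where A: "A = mat22 a b c d" by (rule mat22_cases)
  show ?thesis using assms by (simp add: A matrix_inv_mat22 entry_sum_mat22)
qed

lemma det_cocycle: "(\<And>x. det (A x) = 1) \<Longrightarrow> det (cocycle A n x) = 1"
  by (induction n) (simp_all add: det_mul)

lemma shift_funpow: "(shift ^^ k) x = (\<lambda>i. x (i + int k))"
  by (induction k) (auto simp: shift_def fun_eq_iff algebra_simps)

text \<open>An SL2 matrix and its inverse have the same entries up to signs, so both exponents are read off
  from the growth of the entries.\<close>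

lemma lyap_of_growth:
  assumes det: "\<And>x. det (A x) = 1"
    and K: "0 < K"
    and upper: "\<And>n x. entry_sum (cocycle A n x) \<le> K * exp \<bar>S n x\<bar>"
    and lower: "\<And>n x. exp \<bar>S n x\<bar> \<le> K * entry_sum (cocycle A n x)"
    and lim: "AE x in M. (\<lambda>n. S n x / real n) \<longlonglongrightarrow> L"
  shows "lyap_plus_is M A \<bar>L\<bar>" "lyap_minus_is M A (- \<bar>L\<bar>)"
proof -
  \<comment> \<open>Stated for any \<open>E\<close> with the same entry sums, so that it applies to
    the cocycle and to its inverse alike.\<close>
  have key: "(\<lambda>n. ln (opnorm (E n)) / real n) \<longlonglongrightarrow> \<bar>L\<bar>"
    if E: "\<And>n. entry_sum (E n) = entry_sum (cocycle A n x)"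
      and lim: "(\<lambda>n. S n x / real n) \<longlonglongrightarrow> L" for E x
  proof -
    define c where "c = ln (4 * K)"
    have bnd: "\<bar>ln (opnorm (E n)) - \<bar>S n x\<bar>\<bar> \<le> \<bar>c\<bar> + \<bar>ln K\<bar>" for n
    proof -
      have up: "opnorm (E n) \<le> K * exp \<bar>S n x\<bar>"
        using opnorm_le_entry_sum[of "E n"] upper[of n x] E by simp
      have "exp \<bar>S n x\<bar> \<le> K * (4 * opnorm (E n))"
        using K entry_sum_le_opnorm[of "E n"] unfolding E
        by (intro order_trans[OF lower mult_left_mono]) auto
      hence lo: "exp \<bar>S n x\<bar> \<le> (4 * K) * opnorm (E n)" by simp
      have pos: "0 < opnorm (E n)"
        using lo K opnorm_nonneg[of "E n"] by (cases "opnorm (E n) = 0") auto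
      have "ln (opnorm (E n)) \<le> ln (K * exp \<bar>S n x\<bar>)" using up pos by (rule ln_mono)
      hence "ln (opnorm (E n)) \<le> ln K + \<bar>S n x\<bar>" using K by (simp add: ln_mult)
      moreover have "\<bar>S n x\<bar> \<le> ln ((4 * K) * opnorm (E n))"
        using ln_mono[OF lo] by simp
      hence "\<bar>S n x\<bar> \<le> c + ln (opnorm (E n))" using K pos by (subst (asm) ln_mult) (auto simp: c_def)
      ultimately show ?thesis by linarith
    qed
    have "(\<lambda>n. (ln (opnorm (E n)) - \<bar>S n x\<bar>) / real n) \<longlonglongrightarrow> 0"
    proof (rule Lim_null_comparison)
      show "\<forall>\<^sub>F n in sequentially. norm ((ln (opnorm (E n)) - \<bar>S n x\<bar>) / real n) \<le> (\<bar>c\<bar> + \<bar>ln K\<bar>) / real n"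
        by (intro always_eventually allI) (auto intro!: divide_right_mono bnd)
    qed (rule lim_const_over_n)
    from tendsto_add[OF this tendsto_rabs[OF lim]] show ?thesis
      by (simp flip: add_divide_distrib)
  qed
  show "lyap_plus_is M A \<bar>L\<bar>" unfolding lyap_plus_is_def using lim
    by eventually_elim (rule key, simp_all)
  show "lyap_minus_is M A (- \<bar>L\<bar>)" unfolding lyap_minus_is_def using lim
  proof eventually_elim
    case (elim x)
    have "(\<lambda>n. - (ln (opnorm (matrix_inv (cocycle A n x))) / real n)) \<longlonglongrightarrow> - \<bar>L\<bar>"
      by (intro tendsto_minus key[OF _ elim] entry_sum_matrix_inv det_cocycle det)
    thus ?case by (simp add: ln_inverse)
  qed
qed

section \<open>Occurrences of the word and decay of correlations\<close>

definition word_at :: "nat \<Rightarrow> seq \<Rightarrow> int \<Rightarrow> bool" where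
  "word_at n x t \<longleftrightarrow> (\<forall>i\<in>{t - int n..<t}. \<not> x i) \<and> (\<forall>i\<in>{t..<t + int n}. x i)"

text \<open>Two overlapping occurrences would force a one onto a zero. If the distance is at most n,
  the first one of the left word lies among the zeros of the right word; otherwise the first zero of
  the right word lies among the ones of the left word.\<close>

lemma word_at_unique:
  assumes "word_at n x s" "word_at n x t" "\<bar>s - t\<bar> < 2 * int n"
  shows "s = t"
proof -
  have False if "word_at n x s" "word_at n x t" "s < t" "t - s < 2 * int n" for s t
  proof (cases "t - s \<le> int n")
    case True
    hence "s \<in> {s..<s + int n}" "s \<in> {t - int n..<t}" using that(3,4) by auto
    hence "x s" "\<not> x s" using that(1,2) unfolding word_at_def by blast+
    thus False by simp
  next
    case False
    hence "t - int n \<in> {s..<s + int n}" "t - int n \<in> {t - int n..<t}" using that(3,4) by auto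
    hence "x (t - int n)" "\<not> x (t - int n)" using that(1,2) unfolding word_at_def by blast+
    thus False by simp
  qed
  from this[of s t] this[of t s] assms show ?thesis by (cases s t rule: linorder_cases) auto
qed

lemma word_at_shift: "word_at n (shift x) t \<longleftrightarrow> word_at n x (t + 1)"
proof -
  have "(\<forall>i\<in>{a..<b}. P (i + 1)) \<longleftrightarrow> (\<forall>i\<in>{a + 1..<b + 1}. P i)" for a b :: int and P
  proof -
    have "{a + 1..<b + 1} = (\<lambda>i. i + 1) ` {a..<b}" by simp
    thus ?thesis by (simp only: Set.ball_simps(9))
  qed
  from this[of "t - int n" t "\<lambda>i. \<not> x i"] this[of t "t + int n" x] show ?thesis
    unfolding word_at_def shift_def by (simp add: algebra_simps)
qed

lemma word_at_cong:
  "(\<And>i. t - int n \<le> i \<Longrightarrow> i < t + int n \<Longrightarrow> x i = y i) \<Longrightarrow> word_at n x t = word_at n y t"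
  unfolding word_at_def by auto

abbreviation swap_coords :: "int \<Rightarrow> seq \<Rightarrow> seq" where
  "swap_coords u x \<equiv> x \<circ> Transposition.transpose (u - 1) u"

text \<open>Swapping the last 0 and the first 1 of an occurrence destroys it and, as the result
  has isolated letters there, creates no new one.\<close>

lemma word_at_swap_coords:
  assumes n: "2 \<le> n" and u: "word_at n x u"
  shows "word_at n (swap_coords u x) t \<longleftrightarrow> word_at n x t \<and> t \<noteq> u"
proof (cases "t + int n \<le> u - 1 \<or> u < t - int n")
  case True
  hence "word_at n (swap_coords u x) t = word_at n x t"
    by (intro word_at_cong) (auto simp: Transposition.transpose_def)
  thus ?thesis using True n by auto
next
  case touch: False
  have x: "\<not> x (u - 1)" "\<not> x (u - 2)" "x u" "x (u + 1)"
    using u n unfolding word_at_def by auto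
  hence y: "swap_coords u x (u - 1)" "\<not> swap_coords u x u"
      "\<not> swap_coords u x (u - 2)" "swap_coords u x (u + 1)"
    by (auto simp: Transposition.transpose_def)
  have "\<not> word_at n (swap_coords u x) t"
  proof
    assume w: "word_at n (swap_coords u x) t"
    hence zeros: "\<And>i. t - int n \<le> i \<Longrightarrow> i < t \<Longrightarrow> \<not> swap_coords u x i"
      and ones: "\<And>i. t \<le> i \<Longrightarrow> i < t + int n \<Longrightarrow> swap_coords u x i"
      unfolding word_at_def by auto
    \<comment> \<open>From u - 2 to u + 1 the letters now read 0101. In the third and fifth cases
      the word meets only one of the two swapped letters; as its blocks have length at least 2, it
      then also contains u - 2 or u + 1, with the wrong letter.\<close>
    consider "t = u" | "t \<le> u - 1" "u < t + int n" | "t \<le> u - 1" "t + int n = u"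
      | "t \<ge> u + 1" "t - int n \<le> u - 1" | "t \<ge> u + 1" "t - int n = u"
      using touch by linarith
    thus False
      by cases (use zeros[of "u - 1"] zeros[of "u + 1"] ones[of u] ones[of "u - 2"] y n in auto)
  qed
  moreover have "t = u" if "word_at n x t"
    using that touch by (intro word_at_unique[OF that u]) (use n in linarith)
  ultimately show ?thesis by auto
qed

lemma swap_coords_swap_coords [simp]: "swap_coords u (swap_coords u x) = x"
  by (simp add: fun_eq_iff)

definition sgn_word :: "nat \<Rightarrow> seq \<Rightarrow> int \<Rightarrow> real" where
  "sgn_word n x t = (if word_at n x t then - 1 else 1)"

lemma sgn_word_swap_coords:
  assumes "2 \<le> n" "word_at n x u"
  shows "sgn_word n (swap_coords u x) t = (if t = u then - 1 else 1) * sgn_word n x t"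
  using assms(2) by (cases "t = u") (simp_all only: sgn_word_def word_at_swap_coords[OF assms] simp_thms if_True if_False mult_1 mult_minus_left mult_minus_right minus_minus)

text \<open>The range includes \<open>k\<close>: the letter at the middle of a word is already
  counted with the flipped sign, as required in \<open>cocycle_swapping\<close>.\<close>

definition orientation :: "nat \<Rightarrow> seq \<Rightarrow> nat \<Rightarrow> real" where
  "orientation n x k = (\<Prod>t\<le>k. sgn_word n x (int t))"

lemma abs_prod_sgn_word: "\<bar>\<Prod>t\<in>I. sgn_word n x (f t)\<bar> = 1"
  unfolding abs_prod by (rule prod.neutral) (simp add: sgn_word_def)

text \<open>The signs common to both factors square to 1, so only the flips after j remain.\<close>

lemma orientation_mult:
  assumes "j < k"
  shows "orientation n x j * orientation n x k = (\<Prod>t\<in>{j<..k}. sgn_word n x (int t))"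
proof -
  have "{..k} = {..j} \<union> {j<..k}" using assms by auto
  hence "orientation n x k = orientation n x j * (\<Prod>t\<in>{j<..k}. sgn_word n x (int t))"
    unfolding orientation_def by (simp add: prod.union_disjoint ivl_disj_int)
  moreover have "orientation n x j * orientation n x j = 1"
    unfolding orientation_def prod.distrib[symmetric] by (intro prod.neutral) (simp add: sgn_word_def)
  ultimately show ?thesis by simp
qed

section \<open>Independence and exchangeability under the Bernoulli measure\<close>

context
  fixes p :: real
  assumes p: "0 < p" "p < 1"
begin

private abbreviation (input) "M \<equiv> bernoulli_shift_measure p"

lemma prob_space_bernoulli_shift: "prob_space M"
  unfolding bernoulli_shift_measure_def by (intro prob_space_PiM) (simp add: measure_pmf.prob_space_axioms)

interpretation prob_space M by (rule prob_space_bernoulli_shift)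

lemma space_bernoulli_shift [simp]: "space M = UNIV"
  by (simp add: bernoulli_shift_measure_def space_PiM PiE_UNIV_domain)

lemma sets_bernoulli_shift [measurable_cong]: "sets M = sets (PiM UNIV (\<lambda>_. count_space UNIV))"
  unfolding bernoulli_shift_measure_def by (intro sets_PiM_cong) auto

lemma measurable_coordinate [measurable]: "(\<lambda>x. x i) \<in> measurable M (count_space UNIV)"
  by measurable

lemma indep_coordinates: "indep_vars (\<lambda>_. count_space UNIV) (\<lambda>i x. x i) (UNIV :: int set)"
proof -
  have "distr M (\<Pi>\<^sub>M i\<in>UNIV. measure_pmf (bernoulli_pmf p)) (\<lambda>x. \<lambda>i\<in>UNIV. x i) = M"
    unfolding bernoulli_shift_measure_def by (simp add: restrict_UNIV distr_id)
  moreover have "distr M (measure_pmf (bernoulli_pmf p)) (\<lambda>x. x i) = measure_pmf (bernoulli_pmf p)" for i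
    unfolding bernoulli_shift_measure_def
    by (rule distr_PiM_component) (auto simp: measure_pmf.prob_space_axioms)
  ultimately have "indep_vars (\<lambda>_. measure_pmf (bernoulli_pmf p)) (\<lambda>i x. x i) (UNIV :: int set)"
    by (subst indep_vars_iff_distr_eq_PiM') (auto simp: bernoulli_shift_measure_def)
  thus ?thesis by (simp add: indep_vars_def)
qed

lemma distr_coordinate: "distr M (count_space UNIV) (\<lambda>x. x i) = measure_pmf (bernoulli_pmf p)"
proof -
  have "distr M (count_space UNIV) (\<lambda>x. x i) = distr M (measure_pmf (bernoulli_pmf p)) (\<lambda>x. x i)"
    by (rule distr_cong) auto
  also have "\<dots> = measure_pmf (bernoulli_pmf p)"
    unfolding bernoulli_shift_measure_def
    by (rule distr_PiM_component) (auto simp: measure_pmf.prob_space_axioms)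
  finally show ?thesis .
qed

lemma expectation_coordinate: "expectation (\<lambda>x. g (x i) :: real) = p * g True + (1 - p) * g False"
proof -
  have "expectation (\<lambda>x. g (x i)) = integral\<^sup>L (distr M (count_space UNIV) (\<lambda>x. x i)) g"
    by (subst integral_distr) auto
  thus ?thesis using p by (simp add: distr_coordinate integral_bernoulli_pmf)
qed

lemma prob_coordinate: "prob {x. x i = b} = (if b then p else 1 - p)"
proof -
  have "prob {x. x i = b} = measure (distr M (count_space UNIV) (\<lambda>x. x i)) {b}"
    by (subst measure_distr) (auto simp: vimage_def)
  thus ?thesis using p by (simp add: distr_coordinate measure_pmf_single)
qed

text \<open>All coordinates have the same law, so permuting them preserves the product measure. It
  is applied to the transposition of the two middle letters of a word.\<close>

lemma expectation_reindex:
  assumes "bij \<pi>" and [measurable]: "F \<in> borel_measurable M"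
  shows "expectation (\<lambda>x. F (x \<circ> \<pi>) :: real) = expectation F"
proof -
  have "distr M M (\<lambda>x. \<lambda>i\<in>UNIV. x (\<pi> i)) = M"
    unfolding bernoulli_shift_measure_def using assms(1)
    by (intro distr_PiM_reindex) (auto simp: measure_pmf.prob_space_axioms bij_def)
  hence *: "distr M M (\<lambda>x. x \<circ> \<pi>) = M" by (simp add: comp_def restrict_UNIV)
  have "(\<lambda>x. x \<circ> \<pi>) \<in> measurable M M"
    unfolding measurable_cong_sets[OF refl sets_bernoulli_shift] 
    by (rule measurable_PiM_single') (auto simp: comp_def)
  from integral_distr[OF this assms(2)] show ?thesis by (simp add: *)
qed

lemma measurable_word_at [measurable]: "Measurable.pred M (\<lambda>x. word_at n x t)"
  unfolding word_at_def by measurable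

lemma prob_word_at: "prob {x. word_at n x t} = (p * (1 - p)) ^ n"
proof (cases "n = 0")
  case False
  define A where "A i = (if i < t then {False} else {True})" for i
  define J where "J = {t - int n..<t + int n}"
  have "{x. word_at n x t} = (\<Inter>i\<in>J. (\<lambda>x. x i) -` A i \<inter> space M)"
  proof (intro set_eqI)
    fix x
    have "word_at n x t \<longleftrightarrow> (\<forall>i\<in>J. x i \<in> A i)"
      unfolding word_at_def A_def J_def by (smt (verit) atLeastLessThan_iff insert_iff empty_iff)
    thus "x \<in> {x. word_at n x t} \<longleftrightarrow> x \<in> (\<Inter>i\<in>J. (\<lambda>x. x i) -` A i \<inter> space M)"
      using False by (auto simp: J_def)
  qed
  also have "prob \<dots> = (\<Prod>i\<in>J. prob ((\<lambda>x. x i) -` A i \<inter> space M))"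
    using False by (intro indep_varsD[OF indep_coordinates]) (auto simp: J_def)
  also have "\<dots> = (\<Prod>i\<in>J. if i < t then 1 - p else p)"
  proof (rule prod.cong)
    fix i
    have "(\<lambda>x. x i) -` A i \<inter> space M = {x. x i = (\<not> i < t)}" by (auto simp: A_def)
    thus "prob ((\<lambda>x. x i) -` A i \<inter> space M) = (if i < t then 1 - p else p)"
      by (simp only: prob_coordinate) simp
  qed simp
  also have "\<dots> = (\<Prod>i\<in>{t - int n..<t}. 1 - p) * (\<Prod>i\<in>{t..<t + int n}. p)"
  proof -
    have "J = {t - int n..<t} \<union> {t..<t + int n}" by (auto simp: J_def)
    thus ?thesis by (simp add: prod.union_disjoint ivl_disj_int)
  qed
  finally show ?thesis by (simp add: power_mult_distrib mult.commute)
qed (use prob_space in \<open>simp add: word_at_def\<close>)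

text \<open>The windows of length 2n around the points \<open>u i\<close> are disjoint, so the
  occurrences there are independent events of equal probability.\<close>

lemma prob_no_word_at:
  assumes disj: "\<And>i j. i < m \<Longrightarrow> j < m \<Longrightarrow> i \<noteq> j \<Longrightarrow> \<bar>u i - u j\<bar> \<ge> 2 * int n"
  shows "prob {x. \<forall>i<m. \<not> word_at n x (u i)} = (1 - (p * (1 - p)) ^ n) ^ m"
proof (cases "m = 0")
  case False
  define W where "W i = {u i - int n..<u i + int n}" for i :: nat
  have "indep_vars (\<lambda>i. PiM (W i) (\<lambda>_. count_space UNIV)) (\<lambda>i x. restrict x (W i)) {..<m}"
  proof (rule indep_vars_restrict[OF indep_coordinates])
    show "disjoint_family_on W {..<m}"
      unfolding disjoint_family_on_def W_def
    proof (intro ballI impI)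
      fix i j assume "i \<in> {..<m}" "j \<in> {..<m}" "i \<noteq> j"
      with disj[of i j] show "{u i - int n..<u i + int n} \<inter> {u j - int n..<u j + int n} = {}"
        by auto
    qed
  qed simp
  hence "indep_vars (\<lambda>_. count_space UNIV) (\<lambda>i x. word_at n (restrict x (W i)) (u i)) {..<m}"
  proof (rule indep_vars_compose2)
    fix i
    have "(\<lambda>x. \<forall>j\<in>{u i - int n..<u i}. \<not> x j) \<in> measurable (PiM (W i) (\<lambda>_. count_space UNIV)) (count_space UNIV)"
      "(\<lambda>x. \<forall>j\<in>{u i..<u i + int n}. x j) \<in> measurable (PiM (W i) (\<lambda>_. count_space UNIV)) (count_space UNIV)"
      by (intro measurable_pred_countable; simp add: W_def)+
    thus "(\<lambda>x. word_at n x (u i)) \<in> measurable (PiM (W i) (\<lambda>_. count_space UNIV)) (count_space UNIV)"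
      unfolding word_at_def by (rule pred_intros_logic)
  qed
  moreover have "word_at n (restrict x (W i)) (u i) = word_at n x (u i)" for x i
    by (rule word_at_cong) (simp add: W_def)
  ultimately have ind: "indep_vars (\<lambda>_. count_space UNIV) (\<lambda>i x. word_at n x (u i)) {..<m}" by simp
  have "{x. \<forall>i<m. \<not> word_at n x (u i)} = (\<Inter>i\<in>{..<m}. (\<lambda>x. word_at n x (u i)) -` {False} \<inter> space M)"
    by auto
  also have "prob \<dots> = (\<Prod>i<m. prob ((\<lambda>x. word_at n x (u i)) -` {False} \<inter> space M))"
    using False by (intro indep_varsD[OF ind]) auto
  also have "\<dots> = (\<Prod>i<m. 1 - (p * (1 - p)) ^ n)"
  proof (rule prod.cong)
    fix i
    have "(\<lambda>x. word_at n x (u i)) -` {False} \<inter> space M = space M - {x. word_at n x (u i)}" by auto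
    also have "prob \<dots> = 1 - prob {x. word_at n x (u i)}" 
      by (rule prob_compl) (use measurable_word_at[of n "u i"] in \<open>simp add: pred_def\<close>)
    finally show "prob ((\<lambda>x. word_at n x (u i)) -` {False} \<inter> space M) = 1 - (p * (1 - p)) ^ n"
      by (simp add: prob_word_at)
  qed simp
  finally show ?thesis by simp
qed (use prob_space in simp)

section \<open>Decay of signed correlations and the resulting strong laws\<close>

lemma integrable_bounded_bernoulli:
  assumes [measurable]: "F \<in> borel_measurable M" and "\<And>x. \<bar>F x\<bar> \<le> (B :: real)"
  shows "integrable M F"
proof (rule integrable_const_bound[where B=B])
  show "AE x in M. norm (F x) \<le> B" by (rule AE_I2) (simp only: real_norm_def assms(2))
qed (rule assms(1))

text \<open>Place m disjoint windows between j and k. On the event that a given window is the first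
  to hold the word or its swapped version, exchanging its middle letters preserves the measure and
  the event but negates the integrand, so this event contributes 0. Only the event that no window is
  of this kind is left, and its probability is exponentially small in m.\<close>

lemma orientation_correlation_decay:
  fixes \<phi> :: "bool \<Rightarrow> real"
  assumes n: "2 \<le> n" and \<phi>: "\<And>b. \<bar>\<phi> b\<bar> \<le> K" and jk: "j < k"
  shows "\<bar>expectation (\<lambda>x. (orientation n x j * \<phi> (x (int j))) * (orientation n x k * \<phi> (x (int k))))\<bar>
    \<le> K\<^sup>2 * (1 - (p * (1 - p)) ^ n) ^ ((k - j - 1) div (2 * n))"
proof -
  \<comment> \<open>The number of windows of length 2n that fit strictly between j and k.\<close>
  define m where "m = (k - j - 1) div (2 * n)"
  \<comment> \<open>Window i is [v i - n, v i + n): the first starts at j + 1, the windows are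
    adjacent, and those with i < m end before k.\<close>
  define v where "v i = j + n + 1 + 2 * n * i" for i
  define u where "u i = int (v i)" for i
  define F where "F x = \<phi> (x (int j)) * \<phi> (x (int k)) * (\<Prod>t\<in>{j<..k}. sgn_word n x (int t))" for x
  \<comment> \<open>Symmetric under the swap at \<open>u i\<close>, so that restricting to good
    windows is compatible with the swap.\<close>
  define good where "good i x \<longleftrightarrow> word_at n x (u i) \<or> word_at n (swap_coords (u i) x) (u i)" for i x
  \<comment> \<open>\<open>H i\<close> is the part of F for which window i is the first good one,
    and \<open>R i\<close> is what remains when the parts before i are removed; thus
    \<open>R (Suc i) = R i - H i\<close>.\<close>
  define R where "R i x = (if \<forall>l<i. \<not> good l x then F x else 0)" for i x
  define H where "H i x = (if good i x \<and> (\<forall>l<i. \<not> good l x) then F x else 0)" for i x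
  have F_eq: "(orientation n x j * \<phi> (x (int j))) * (orientation n x k * \<phi> (x (int k))) = F x" for x
    unfolding F_def orientation_mult[OF jk, symmetric] by simp
  have [measurable]: "Measurable.pred M (good i)" for i
    unfolding good_def word_at_def comp_def by measurable
  have F_meas [measurable]: "F \<in> borel_measurable M"
    unfolding F_def sgn_word_def by measurable
  have [measurable]: "R i \<in> borel_measurable M" "H i \<in> borel_measurable M" for i
    unfolding R_def H_def by measurable
  have K: "0 \<le> K" using \<phi>[of True] by linarith
  have F_bound: "\<bar>F x\<bar> \<le> K\<^sup>2" for x
    unfolding F_def abs_mult abs_prod_sgn_word power2_eq_square
    using mult_mono[OF \<phi> \<phi> K abs_ge_zero] by simp
  have int: "integrable M (R i)" "integrable M (H i)" for i
    by (rule integrable_bounded_bernoulli[where B="K\<^sup>2"]; use F_bound in \<open>simp add: R_def H_def\<close>)+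
  have far: "\<bar>u i - u l\<bar> \<ge> 2 * int n" if "i \<noteq> l" for i l
  proof -
    have "\<bar>u i - u l\<bar> = 2 * int n * \<bar>int i - int l\<bar>"
      by (simp add: u_def v_def abs_mult flip: right_diff_distrib)
    moreover have "2 * int n * 1 \<le> 2 * int n * \<bar>int i - int l\<bar>"
      using that by (intro mult_left_mono) auto
    ultimately show ?thesis by simp
  qed
  \<comment> \<open>A swap moves letters only within its own window, and for that window goodness is
    symmetric.\<close>
  have good_swap: "good l (swap_coords (u i) x) \<longleftrightarrow> good l x" for i l x
  proof (cases "i = l")
    case True thus ?thesis by (auto simp: good_def)
  next
    case False
    have *: "swap_coords (u i) x t = x t" if "u l - int n \<le> t" "t < u l + int n" for t
      using far[OF False] that n by (auto simp: Transposition.transpose_def)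
    have "word_at n (swap_coords (u i) x) (u l) = word_at n x (u l)"
      by (rule word_at_cong) (rule *)
    moreover have "word_at n (swap_coords (u l) (swap_coords (u i) x)) (u l)
        = word_at n (swap_coords (u l) x) (u l)"
    proof (rule word_at_cong)
      fix t assume t: "u l - int n \<le> t" "t < u l + int n"
      have "u l - int n \<le> Transposition.transpose (u l - 1) (u l) t"
          "Transposition.transpose (u l - 1) (u l) t < u l + int n"
        using t n by (auto simp: Transposition.transpose_def)
      from *[OF this] show "swap_coords (u l) (swap_coords (u i) x) t = swap_coords (u l) x t"
        by simp
    qed
    ultimately show ?thesis by (simp add: good_def)
  qed
  have v_bound: "j + 1 < v i" "v i < k" if "i < m" for i
  proof -
    have "2 * n * (i + 1) \<le> 2 * n * m" using that by (intro mult_left_mono) auto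
    also have "\<dots> \<le> k - j - 1" unfolding m_def by simp
    finally show "j + 1 < v i" "v i < k" using n jk by (auto simp: v_def)
  qed
  \<comment> \<open>The swap deletes one occurrence, whose sign is a factor of the product because j
    < v i < k, and it leaves the letters at j and k alone.\<close>
  have F_flip: "F (swap_coords (u i) x) = - F x" if w: "word_at n x (u i)" and i: "i < m" for i x
  proof -
    have "(\<Prod>t\<in>{j<..k}. sgn_word n (swap_coords (u i) x) (int t))
      = (\<Prod>t\<in>{j<..k}. if t = v i then - 1 else 1) * (\<Prod>t\<in>{j<..k}. sgn_word n x (int t))"
      unfolding sgn_word_swap_coords[OF n w] by (simp add: u_def prod.distrib)
    moreover have "(\<Prod>t\<in>{j<..k}. if t = v i then - 1 else (1::real)) = - 1"
      using v_bound[OF i] by (subst prod.delta) auto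
    moreover have "swap_coords (u i) x (int j) = x (int j)" "swap_coords (u i) x (int k) = x (int k)"
      using v_bound[OF i] by (auto simp: u_def Transposition.transpose_def)
    ultimately show ?thesis unfolding F_def by simp
  qed
  \<comment> \<open>\<open>H i\<close> is negated by a measure-preserving swap, so its mean is its
    own negative. If only the swapped sequence holds the word, \<open>F_flip\<close> is applied to
    that sequence.\<close>
  have "expectation (H i) = 0" if i: "i < m" for i
  proof -
    have "H i (swap_coords (u i) x) = - H i x" for x
    proof (cases "good i x")
      case True
      have "F (swap_coords (u i) x) = - F x"
      proof (cases "word_at n x (u i)")
        case False
        hence "word_at n (swap_coords (u i) x) (u i)" using True by (simp add: good_def)
        from F_flip[OF this i] show ?thesis by (simp only: swap_coords_swap_coords)
      qed (rule F_flip[OF _ i])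
      thus ?thesis unfolding H_def good_swap by auto
    next
      case False thus ?thesis unfolding H_def good_swap by simp
    qed
    hence "expectation (H i) = expectation (\<lambda>x. - H i x)"
      using expectation_reindex[of "Transposition.transpose (u i - 1) (u i)" "H i"] by simp
    thus ?thesis by simp
  qed
  hence "expectation (R i) = expectation F" if "i \<le> m" for i
    using that
  proof (induction i)
    case 0 thus ?case by (simp add: R_def)
  next
    case (Suc i)
    have split: "(if P \<and> \<not> Q then a else 0) = (if P then a else 0) - (if Q \<and> P then a else 0)"
      for P Q and a :: real by simp
    have first: "(\<forall>l<Suc i. \<not> good l x) \<longleftrightarrow> (\<forall>l<i. \<not> good l x) \<and> \<not> good i x" for x
      by (auto simp: less_Suc_eq)
    have "R (Suc i) = (\<lambda>x. R i x - H i x)"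
      unfolding R_def H_def first split ..
    thus ?case using Suc int by simp
  qed
  hence "\<bar>expectation F\<bar> = \<bar>expectation (R m)\<bar>" by simp
  also have "\<dots> \<le> expectation (\<lambda>x. \<bar>R m x\<bar>)" by (rule integral_abs_bound)
  \<comment> \<open>If no window is good, then in particular none holds the word; the latter event
    is computed by independence.\<close>
  also have "\<dots> \<le> expectation (\<lambda>x. K\<^sup>2 * indicator {x. \<forall>i<m. \<not> word_at n x (u i)} x)"
  proof (rule integral_mono)
    have "{x. \<forall>i<m. \<not> word_at n x (u i)} = {x \<in> space M. \<forall>i<m. \<not> word_at n x (u i)}" by simp
    also have "\<dots> \<in> sets M" by measurable
    finally show "integrable M (\<lambda>x. K\<^sup>2 * indicator {x. \<forall>i<m. \<not> word_at n x (u i)} x)"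
      by (intro integrable_mult_right integrable_real_indicator) (auto simp: emeasure_eq_measure)
    show "\<bar>R m x\<bar> \<le> K\<^sup>2 * indicator {x. \<forall>i<m. \<not> word_at n x (u i)} x" for x
      using F_bound[of x] by (auto simp: R_def good_def)
  qed (use int in auto)
  also have "\<dots> = K\<^sup>2 * prob {x. \<forall>i<m. \<not> word_at n x (u i)}" by simp
  also have "prob {x. \<forall>i<m. \<not> word_at n x (u i)} = (1 - (p * (1 - p)) ^ n) ^ m"
    by (rule prob_no_word_at) (rule far)
  finally show ?thesis unfolding F_eq m_def .
qed

text \<open>Since (d - 1) div L \<ge> d/L - 1, a bound counting windows becomes a geometric bound in
  the distance d, the form that the strong law asks for.\<close>

lemma power_div_le_geometric:
  fixes \<rho> :: real
  assumes "0 < \<rho>" "\<rho> < 1" "0 < L"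
  shows "\<rho> ^ ((d - 1) div L) \<le> inverse \<rho> * (\<rho> powr (1 / real L)) ^ d"
proof -
  have "d \<le> L * ((d - 1) div L) + L"
    using assms(3) mod_less_divisor[of L "d - 1"] mult_div_mod_eq[of L "d - 1"] by linarith
  hence "real d \<le> real (L * ((d - 1) div L) + L)" by (rule of_nat_mono)
  hence le: "real d / real L - 1 \<le> real ((d - 1) div L)"
    using assms(3) by (simp add: field_simps)
  have "\<rho> ^ ((d - 1) div L) = \<rho> powr real ((d - 1) div L)" using assms by (simp add: powr_realpow)
  also have "\<dots> \<le> \<rho> powr (real d / real L - 1)"
    using le assms by (intro powr_mono') auto
  also have "\<dots> = inverse \<rho> * (\<rho> powr (1 / real L)) ^ d"
    using assms by (simp add: powr_diff powr_power inverse_eq_divide)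
  finally show ?thesis .
qed

text \<open>The random sign alone produces the decay, so the limit is 0 even when \<phi> has nonzero
  mean. This is what makes the perturbed exponents vanish.\<close>

theorem orientation_sum_sublinear:
  fixes \<phi> :: "bool \<Rightarrow> real"
  assumes n: "2 \<le> n"
  shows "AE x in M. (\<lambda>N. (\<Sum>k<N. orientation n x k * \<phi> (x (int k))) / real N) \<longlonglongrightarrow> 0"
proof -
  define K where "K = max \<bar>\<phi> True\<bar> \<bar>\<phi> False\<bar>"
  have \<phi>: "\<bar>\<phi> b\<bar> \<le> K" for b by (cases b) (auto simp: K_def)
  define \<rho> where "\<rho> = 1 - (p * (1 - p)) ^ n"
  have "0 < p * (1 - p)" using p by simp
  moreover have "p * (1 - p) < 1 * 1" by (rule mult_strict_mono) (use p in auto)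
  ultimately have \<rho>: "0 < \<rho>" "\<rho> < 1" using n by (auto simp: \<rho>_def power_less_one_iff)
  show ?thesis
  proof (rule strong_law_decaying_correlations[where K=K and C="K\<^sup>2 * inverse \<rho>" and r="\<rho> powr (1 / real (2 * n))"])
    show "(\<lambda>x. orientation n x k * \<phi> (x (int k))) \<in> borel_measurable M" for k
      unfolding orientation_def sgn_word_def by measurable
    show "\<bar>orientation n x k * \<phi> (x (int k))\<bar> \<le> K" for k x
      using \<phi> by (simp add: abs_mult orientation_def abs_prod_sgn_word)
    show "\<bar>expectation (\<lambda>x. (orientation n x j * \<phi> (x (int j))) * (orientation n x k * \<phi> (x (int k))))\<bar>
        \<le> K\<^sup>2 * inverse \<rho> * (\<rho> powr (1 / real (2 * n))) ^ (k - j)" if "j < k" for j k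
    proof -
      have "K\<^sup>2 * \<rho> ^ ((k - j - 1) div (2 * n))
          \<le> K\<^sup>2 * (inverse \<rho> * (\<rho> powr (1 / real (2 * n))) ^ (k - j))"
        using \<rho> n by (intro mult_left_mono power_div_le_geometric) auto
      with orientation_correlation_decay[where \<phi>=\<phi> and K=K, OF n \<phi> that] show ?thesis
        unfolding \<rho>_def by (simp add: mult.assoc)
    qed
    show "\<rho> powr (1 / real (2 * n)) < 1"
      using powr_less_mono2[of "1 / real (2 * n)" \<rho> 1] \<rho> n by simp
  qed (use \<rho> in auto)
qed

text \<open>After centring, distinct coordinates are uncorrelated, so the strong law applies with C
  = 0 and r = 0.\<close>

theorem coordinate_strong_law:
  fixes \<phi> :: "bool \<Rightarrow> real"
  shows "AE x in M. (\<lambda>N. (\<Sum>k<N. \<phi> (x (int k))) / real N) \<longlonglongrightarrow> p * \<phi> True + (1 - p) * \<phi> False"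
proof -
  define \<mu> where "\<mu> = p * \<phi> True + (1 - p) * \<phi> False"
  define \<psi> where "\<psi> b = \<phi> b - \<mu>" for b
  define K where "K = max \<bar>\<psi> True\<bar> \<bar>\<psi> False\<bar>"
  have E0: "expectation (\<lambda>x. \<psi> (x i)) = 0" for i
    unfolding expectation_coordinate by (simp add: \<psi>_def \<mu>_def algebra_simps)
  have K: "\<bar>\<psi> b\<bar> \<le> K" for b by (cases b) (auto simp: K_def)
  have uncorrelated: "expectation (\<lambda>x. \<psi> (x i) * \<psi> (x l)) = 0" if "i \<noteq> l" for i l
  proof -
    have "indep_vars (\<lambda>_. borel) (\<lambda>i x. \<psi> (x i)) {i, l}"
      by (rule indep_vars_subset[OF indep_vars_compose2[OF indep_coordinates]]) auto
    hence "expectation (\<lambda>x. \<Prod>i\<in>{i, l}. \<psi> (x i)) = (\<Prod>i\<in>{i, l}. expectation (\<lambda>x. \<psi> (x i)))"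
      by (intro indep_vars_lebesgue_integral) (auto intro!: integrable_bounded_bernoulli K)
    thus ?thesis using that by (simp add: E0)
  qed
  have "AE x in M. (\<lambda>N. (\<Sum>k<N. \<psi> (x (int k))) / real N) \<longlonglongrightarrow> 0"
    by (rule strong_law_decaying_correlations[where K=K and C=0 and r=0])
       (auto simp: uncorrelated intro!: K)
  thus ?thesis
  proof eventually_elim
    case (elim x)
    have "(\<lambda>N. (\<Sum>k<N. \<psi> (x (int k))) / real N + \<mu>) \<longlonglongrightarrow> 0 + \<mu>"
      by (intro tendsto_intros elim)
    moreover have "\<forall>\<^sub>F N in sequentially. (\<Sum>k<N. \<psi> (x (int k))) / real N + \<mu> = (\<Sum>k<N. \<phi> (x (int k))) / real N"
      using eventually_gt_at_top[of 0]
      by eventually_elim (simp add: \<psi>_def sum_subtractf field_simps)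
    ultimately show ?case unfolding \<mu>_def by (simp add: tendsto_cong)
  qed
qed

end

section \<open>The perturbed cocycle\<close>

lemma agree_len_le:
  assumes "x k \<noteq> y k" shows "agree_len x y \<le> nat \<bar>k\<bar>"
  unfolding agree_len_def
proof (rule cSup_least)
  fix N assume "N \<in> {N. \<forall>n. \<bar>n\<bar> < int N \<longrightarrow> x n = y n}"
  with assms have "\<not> \<bar>k\<bar> < int N" by blast
  thus "N \<le> nat \<bar>k\<bar>" by linarith
qed (auto intro!: exI[of _ 0])

text \<open>Sequences on which F differs disagree within distance r of the origin, hence are at
  least 2^(-r) apart, while F varies by at most 2U.\<close>

lemma local_function_holder:
  fixes F :: "seq \<Rightarrow> real"
  assumes \<alpha>: "0 < \<alpha>" and bnd: "\<And>x. \<bar>F x\<bar> \<le> U"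
    and dep: "\<And>x y. (\<And>k. \<bar>k\<bar> \<le> int r \<Longrightarrow> x k = y k) \<Longrightarrow> F x = F y"
  shows "\<bar>F x - F y\<bar> \<le> 2 * U * 2 powr (\<alpha> * real r) * shift_dist x y powr \<alpha>"
proof (cases "\<forall>k. \<bar>k\<bar> \<le> int r \<longrightarrow> x k = y k")
  case True
  hence "F x = F y" by (intro dep) auto
  thus ?thesis using bnd[of x] by simp
next
  case False
  then obtain k where k: "\<bar>k\<bar> \<le> int r" "x k \<noteq> y k" by auto
  hence "real (agree_len x y) \<le> real r" using agree_len_le[of x k y] by linarith
  hence "2 powr - real r \<le> shift_dist x y"
    using k(2) by (auto simp: shift_dist_def)
  hence "(2 powr - real r) powr \<alpha> \<le> shift_dist x y powr \<alpha>"
    using \<alpha> by (intro powr_mono2) auto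
  hence "2 powr (\<alpha> * real r) * (2 powr - real r) powr \<alpha> \<le> 2 powr (\<alpha> * real r) * shift_dist x y powr \<alpha>"
    by (intro mult_left_mono) auto
  moreover have "2 powr (\<alpha> * real r) * (2 powr - real r) powr \<alpha> = 1"
    by (simp add: powr_powr mult.commute flip: powr_add)
  ultimately have "1 \<le> 2 powr (\<alpha> * real r) * shift_dist x y powr \<alpha>" by linarith
  moreover have "\<bar>F x - F y\<bar> \<le> 2 * U" using bnd[of x] bnd[of y] by linarith
  moreover have "0 \<le> U" using bnd[of x] by linarith
  ultimately show ?thesis
    using mult_left_mono[of 1 "2 powr (\<alpha> * real r) * shift_dist x y powr \<alpha>" "2 * U"]
    by (simp add: mult.assoc)
qed

lemma holder_map_mat22:
  assumes "\<And>x y. \<bar>a x - a y\<bar> \<le> Ca * shift_dist x y powr \<alpha>" "\<And>x y. \<bar>b x - b y\<bar> \<le> Cb * shift_dist x y powr \<alpha>"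
    "\<And>x y. \<bar>c x - c y\<bar> \<le> Cc * shift_dist x y powr \<alpha>" "\<And>x y. \<bar>d x - d y\<bar> \<le> Cd * shift_dist x y powr \<alpha>"
  shows "holder_map \<alpha> (\<lambda>x. mat22 (a x) (b x) (c x) (d x))"
  unfolding holder_map_def
proof (intro exI allI)
  fix x y
  have "opnorm (mat22 (a x) (b x) (c x) (d x) - mat22 (a y) (b y) (c y) (d y))
      \<le> \<bar>a x - a y\<bar> + \<bar>b x - b y\<bar> + \<bar>c x - c y\<bar> + \<bar>d x - d y\<bar>"
    unfolding mat22_diff entry_sum_mat22[symmetric] by (rule opnorm_le_entry_sum)
  also have "\<dots> \<le> (Ca + Cb + Cc + Cd) * shift_dist x y powr \<alpha>"
    using assms(1)[of x y] assms(2)[of x y] assms(3)[of x y] assms(4)[of x y]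
    unfolding distrib_right by linarith
  finally show "opnorm (mat22 (a x) (b x) (c x) (d x) - mat22 (a y) (b y) (c y) (d y))
    \<le> (Ca + Cb + Cc + Cd) * shift_dist x y powr \<alpha>" .
qed

lemma holder_norm_antidiagonal_le:
  assumes b: "\<And>x. \<bar>b x\<bar> \<le> U" and c: "\<And>x. \<bar>c x\<bar> \<le> W"
    and hb: "\<And>x y. \<bar>b x - b y\<bar> \<le> Cb * shift_dist x y powr \<alpha>"
    and hc: "\<And>x y. \<bar>c x - c y\<bar> \<le> Cc * shift_dist x y powr \<alpha>"
  shows "holder_norm \<alpha> (\<lambda>x. mat22 0 (b x) (c x) 0) \<le> (U + W) + (Cb + Cc)"
  unfolding holder_norm_def
proof (rule add_mono)
  show "(SUP x. opnorm (mat22 0 (b x) (c x) 0)) \<le> U + W"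
  proof (rule cSUP_least)
    fix x show "opnorm (mat22 0 (b x) (c x) 0) \<le> U + W"
      using opnorm_le_entry_sum[of "mat22 0 (b x) (c x) 0"] b[of x] c[of x]
      unfolding entry_sum_mat22 by simp
  qed simp
  show "(SUP xy \<in> {(x, y). x \<noteq> y}. opnorm (mat22 0 (b (fst xy)) (c (fst xy)) 0 - mat22 0 (b (snd xy)) (c (snd xy)) 0)
      / shift_dist (fst xy) (snd xy) powr \<alpha>) \<le> Cb + Cc"
  proof (rule cSUP_least)
    \<comment> \<open>A real supremum is controlled by its upper bounds only over a nonempty
      set.\<close>
    have "((\<lambda>_. True), (\<lambda>_. False)) \<in> {(x :: seq, y :: seq). x \<noteq> y}" by (auto simp: fun_eq_iff)
    thus "{(x :: seq, y :: seq). x \<noteq> y} \<noteq> {}" by blast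
    fix xy :: "seq \<times> seq" assume xy: "xy \<in> {(x, y). x \<noteq> y}"
    define x y where "x = fst xy" and "y = snd xy"
    have "x \<noteq> y" using xy by (auto simp: x_def y_def)
    hence pos: "0 < shift_dist x y powr \<alpha>" by (simp add: shift_dist_def)
    have "opnorm (mat22 0 (b x) (c x) 0 - mat22 0 (b y) (c y) 0) \<le> \<bar>b x - b y\<bar> + \<bar>c x - c y\<bar>"
      using opnorm_le_entry_sum[of "mat22 0 (b x) (c x) 0 - mat22 0 (b y) (c y) 0"]
      unfolding mat22_diff entry_sum_mat22 by simp
    also have "\<dots> \<le> (Cb + Cc) * shift_dist x y powr \<alpha>"
      using hb[of x y] hc[of x y] unfolding distrib_right by linarith
    finally show "opnorm (mat22 0 (b (fst xy)) (c (fst xy)) 0 - mat22 0 (b (snd xy)) (c (snd xy)) 0)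
      / shift_dist (fst xy) (snd xy) powr \<alpha> \<le> Cb + Cc"
      using pos unfolding x_def y_def by (simp add: pos_divide_le_eq)
  qed
qed

section \<open>Exponents of the diagonal cocycle\<close>

definition log_rate :: "real \<Rightarrow> real \<Rightarrow> bool \<Rightarrow> real" where
  "log_rate \<sigma> \<eta> b = (if b then ln \<sigma> else - ln \<eta>)"

lemma A_sigma_eta_eq_mat22:
  assumes "0 < \<eta>" "0 < \<sigma>"
  shows "A_sigma_eta \<sigma> \<eta> x = mat22 (exp (log_rate \<sigma> \<eta> (x 0))) 0 0 (exp (- log_rate \<sigma> \<eta> (x 0)))"
  using assms by (simp add: A_sigma_eta_def mat2_eq_iff log_rate_def exp_minus)

lemma cocycle_A_sigma_eta:
  assumes "0 < \<eta>" "0 < \<sigma>"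
  defines "S \<equiv> \<lambda>n x. \<Sum>k<n. log_rate \<sigma> \<eta> (x (int k))"
  shows "cocycle (A_sigma_eta \<sigma> \<eta>) n x = mat22 (exp (S n x)) 0 0 (exp (- S n x))"
  by (induction n)
     (simp_all add: S_def mat_1_eq_mat22 A_sigma_eta_eq_mat22[OF assms(1,2)] shift_funpow add.commute flip: exp_add)

text \<open>The iterates are diagonal with entries exp(S) and exp(-S), so their size is exp
  \<bar>S\<bar> up to a factor 2, and S obeys the strong law for the letters.\<close>

lemma lyap_A_sigma_eta:
  assumes p: "0 < p" "p < 1" and "0 < \<eta>" "0 < \<sigma>"
  defines "L \<equiv> \<bar>(1 - p) * ln \<eta> - p * ln \<sigma>\<bar>"
  shows "lyap_plus_is (bernoulli_shift_measure p) (A_sigma_eta \<sigma> \<eta>) L"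
    "lyap_minus_is (bernoulli_shift_measure p) (A_sigma_eta \<sigma> \<eta>) (- L)"
proof -
  define S where "S n x = (\<Sum>k<n. log_rate \<sigma> \<eta> (x (int k)))" for n and x :: seq
  have es: "entry_sum (cocycle (A_sigma_eta \<sigma> \<eta>) n x) = exp (S n x) + exp (- S n x)" for n x
    unfolding cocycle_A_sigma_eta[OF assms(3,4)] S_def entry_sum_mat22 by simp
  have bounds: "exp s + exp (- s) \<le> 2 * exp \<bar>s\<bar>" "exp \<bar>s\<bar> \<le> 2 * (exp s + exp (- s))" for s :: real
  proof -
    have "exp s \<le> exp \<bar>s\<bar>" "exp (- s) \<le> exp \<bar>s\<bar>" by simp_all
    thus "exp s + exp (- s) \<le> 2 * exp \<bar>s\<bar>" by linarith
    show "exp \<bar>s\<bar> \<le> 2 * (exp s + exp (- s))"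
      using exp_gt_zero[of s] exp_gt_zero[of "- s"] by (cases "0 \<le> s") (simp_all del: exp_gt_zero)
  qed
  have L: "L = \<bar>p * log_rate \<sigma> \<eta> True + (1 - p) * log_rate \<sigma> \<eta> False\<bar>"
    unfolding L_def log_rate_def by simp
  have "det (A_sigma_eta \<sigma> \<eta> x) = 1" for x
    unfolding A_sigma_eta_eq_mat22[OF assms(3,4)] by (simp flip: exp_add)
  note growth = lyap_of_growth[where K=2 and S=S, OF this _ _ _ coordinate_strong_law[OF p, of "log_rate \<sigma> \<eta>", folded S_def]]
  show "lyap_plus_is (bernoulli_shift_measure p) (A_sigma_eta \<sigma> \<eta>) L"
      "lyap_minus_is (bernoulli_shift_measure p) (A_sigma_eta \<sigma> \<eta>) (- L)"
    unfolding L by (rule growth; simp only: es bounds; simp)+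
qed

section \<open>Conjugacy to a monomial cocycle by bounded shears\<close>

lemma word_at_shift_funpow: "word_at n ((shift ^^ k) x) t \<longleftrightarrow> word_at n x (t + int k)"
  by (induction k arbitrary: t) (simp_all add: word_at_shift algebra_simps)

context
  fixes n :: nat and \<kappa> \<eta> \<sigma> :: real
  assumes n: "2 \<le> n" and \<kappa>: "1 \<le> \<kappa>" and \<eta>: "1 < \<eta>" and \<sigma>: "\<eta> < \<sigma>"
begin

private abbreviation (input) "rate \<equiv> log_rate \<sigma> \<eta>"

text \<open>Slope of the shear accumulated by the perturbation below when the middle of the current word
  lies t letters ahead.\<close>

definition slope :: "int \<Rightarrow> real" where
  "slope t = (if 0 \<le> t then \<kappa> * \<eta> powr (- 2 * real_of_int t) else - \<kappa> * \<sigma> powr (2 * real_of_int t))"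

text \<open>The range selects the words that contain the coordinate -1, the letter just read. By
  \<open>word_at_unique\<close> at most one term is nonzero.\<close>

definition shear :: "seq \<Rightarrow> real" where
  "shear x = (\<Sum>t\<in>{- int n..<int n}. if word_at n x t then slope t else 0)"

text \<open>The two outer shears: the first term starts a slope when a word begins at 0, the second
  cancels the slope left over from a word that ended at -1.\<close>

definition kick :: "seq \<Rightarrow> real" where
  "kick x = (if word_at n x (int n) then slope (int n) else 0)
    - (if word_at n x (- int n) then slope (- int n) else 0)"

text \<open>\<open>A_sigma_eta\<close> times, on the right, the upper shear by -1/\<kappa> at the
  middle of a word, or else the lower shear by \<open>kick x\<close>. By \<open>kick_eq_0\<close>
  the two never act together, so the determinant stays 1.\<close>

definition perturbed :: "seq \<Rightarrow> mat2" where
  "perturbed x = mat22 (exp (rate (x 0))) (if word_at n x 0 then - exp (rate (x 0)) / \<kappa> else 0)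
     (exp (- rate (x 0)) * kick x) (exp (- rate (x 0)))"

definition swapping :: "seq \<Rightarrow> mat2" where
  "swapping x = (if word_at n x 0 then mat22 0 (- exp (rate (x 0)) / \<kappa>) (exp (- rate (x 0)) * \<kappa>) 0
     else mat22 (exp (rate (x 0))) 0 0 (exp (- rate (x 0))))"

lemma kick_eq_0: "word_at n x 0 \<Longrightarrow> kick x = 0"
  unfolding kick_def using word_at_unique[of n x 0 "int n"] word_at_unique[of n x 0 "- int n"] n by auto

lemma det_perturbed: "det (perturbed x) = 1"
  by (cases "word_at n x 0") (simp_all add: perturbed_def kick_eq_0 flip: exp_add)

text \<open>Conjugating a lower shear by diag(e^r, e^(-r)) multiplies its slope by e^(-2r). Thus the
  slope grows by \<eta>^2 at each zero until it reaches \<kappa> and, after the jump at t = 0,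
  shrinks by \<sigma>^(-2) at each one.\<close>

lemma slope_step:
  assumes "t \<noteq> 0" "- int n < t" "t \<le> int n" "word_at n x t"
  shows "slope (t - 1) = exp (- 2 * rate (x 0)) * slope t"
proof (cases "0 < t")
  case True
  have "\<not> x 0" using assms True unfolding word_at_def by auto
  hence "exp (- 2 * rate (x 0)) = \<eta> powr 2"
    using \<eta> by (simp add: log_rate_def powr_def)
  moreover have "slope (t - 1) = \<eta> powr 2 * slope t"
    using True by (simp add: slope_def flip: powr_add) 
  ultimately show ?thesis by simp
next
  case False
  have "x 0" using assms False unfolding word_at_def by auto
  hence "exp (- 2 * rate (x 0)) = \<sigma> powr (- 2)"
    using \<eta> \<sigma> by (simp add: log_rate_def powr_def)
  moreover have "slope (t - 1) = \<sigma> powr (- 2) * slope t"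
    using False assms(1) by (simp add: slope_def flip: powr_add)
  ultimately show ?thesis by simp
qed

lemma shear_shift_eq: "shear (shift x) = (\<Sum>t\<in>{- int n<..int n}. if word_at n x t then slope (t - 1) else 0)"
  unfolding shear_def word_at_shift
  by (rule sum.reindex_bij_witness[of _ "\<lambda>t. t - 1" "\<lambda>t. t + 1"]) auto

text \<open>\<open>kick\<close> exchanges the boundary term at -n for the one at n, giving exactly
  the range that appears in \<open>shear_shift_eq\<close>.\<close>

lemma shear_add_kick: "shear x + kick x = (\<Sum>t\<in>{- int n<..int n}. if word_at n x t then slope t else 0)"
proof -
  let ?f = "\<lambda>t. if word_at n x t then slope t else 0"
  have "{- int n..<int n} = insert (- int n) {- int n<..<int n}"
    "{- int n<..int n} = insert (int n) {- int n<..<int n}"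
    using n by auto
  thus ?thesis unfolding shear_def kick_def by simp
qed

lemma shear_shift:
  assumes "\<not> word_at n x 0"
  shows "shear (shift x) = exp (- 2 * rate (x 0)) * (shear x + kick x)"
  unfolding shear_shift_eq shear_add_kick sum_distrib_left
proof (rule sum.cong)
  fix t assume "t \<in> {- int n<..int n}"
  thus "(if word_at n x t then slope (t - 1) else 0) = exp (- 2 * rate (x 0)) * (if word_at n x t then slope t else 0)"
    using slope_step[of t x] assms by (cases "t = 0") auto
qed simp

lemma shear_at_word:
  assumes w: "word_at n x 0"
  shows "shear x = \<kappa>" "shear (shift x) = - \<kappa> * exp (- 2 * rate (x 0))" "x 0"
proof -
  have only: "word_at n x t \<longleftrightarrow> t = 0" if "- int n \<le> t" "t \<le> int n" for t
    using word_at_unique[OF _ w, of t] w that n by auto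
  show x0: "x 0" using w n unfolding word_at_def by auto
  have "shear x = (\<Sum>t\<in>{- int n..<int n}. if t = 0 then slope t else 0)"
    unfolding shear_def by (rule sum.cong) (auto simp: only)
  thus "shear x = \<kappa>" using n \<eta> by (simp add: slope_def)
  have "shear (shift x) = (\<Sum>t\<in>{- int n<..int n}. if t = 0 then slope (t - 1) else 0)"
    unfolding shear_shift_eq by (rule sum.cong) (auto simp: only)
  also have "\<dots> = - \<kappa> * \<sigma> powr (- 2)" using n by (simp add: slope_def)
  finally show "shear (shift x) = - \<kappa> * exp (- 2 * rate (x 0))"
    using x0 \<eta> \<sigma> by (simp add: log_rate_def powr_def)
qed

text \<open>Away from the middle of a word this is the transport of slopes. At the middle it rests
  on U(-1/\<kappa>) L(\<kappa>) = L(-\<kappa>) J, where J is antidiagonal with entries -1/\<kappa>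
  and \<kappa>; this is why the slope jumps from \<kappa> to -\<kappa> before being scaled.\<close>

lemma perturbed_conjugate: "perturbed x ** mat22 1 0 (shear x) 1 = mat22 1 0 (shear (shift x)) 1 ** swapping x"
proof (cases "word_at n x 0")
  case True
  have "exp (- 2 * rate (x 0)) * exp (rate (x 0)) = exp (- rate (x 0))" by (simp flip: exp_add)
  thus ?thesis using True \<kappa> by (simp add: perturbed_def swapping_def kick_eq_0 shear_at_word)
next
  case False
  have "exp (- 2 * rate (x 0)) * exp (rate (x 0)) = exp (- rate (x 0))" by (simp flip: exp_add)
  thus ?thesis using False
    by (simp add: perturbed_def swapping_def shear_shift mult.assoc mult.left_commute[of _ "exp (rate (x 0))"] distrib_left)
       (simp add: algebra_simps flip: exp_add)
qed

lemma cocycle_perturbed_conjugate: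
  "cocycle perturbed N x ** mat22 1 0 (shear x) 1 = mat22 1 0 (shear ((shift ^^ N) x)) 1 ** cocycle swapping N x"
proof (induction N)
  case (Suc N)
  have "cocycle perturbed (Suc N) x ** mat22 1 0 (shear x) 1
     = perturbed ((shift ^^ N) x) ** (cocycle perturbed N x ** mat22 1 0 (shear x) 1)"
    by (simp only: cocycle.simps matrix_mul_assoc)
  also have "\<dots> = (perturbed ((shift ^^ N) x) ** mat22 1 0 (shear ((shift ^^ N) x)) 1) ** cocycle swapping N x"
    unfolding Suc.IH by (simp only: matrix_mul_assoc)
  finally show ?case unfolding perturbed_conjugate by (simp add: matrix_mul_assoc del: mat22_mult)
qed simp

text \<open>The numbers a and b follow the images of the two basis vectors; the sign product tells
  which axis they lie on, hence whether a letter counts with its rate or the opposite. The factors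
  \<kappa> and 1/\<kappa> cancel at every second swap and so do not accumulate.\<close>

lemma cocycle_swapping:
  defines "S \<equiv> \<lambda>N x. \<Sum>k<N. orientation n x k * rate (x (int k))"
  shows "\<exists>a b. \<bar>a\<bar> = exp (S N x) \<and> \<bar>b\<bar> = exp (- S N x) \<and>
     cocycle swapping N x = (if (\<Prod>t<N. sgn_word n x (int t)) = 1 then mat22 a 0 0 b else mat22 0 (b / \<kappa>) (\<kappa> * a) 0)"
proof (induction N)
  case 0 show ?case
    by (rule exI[of _ 1], rule exI[of _ 1]) (simp add: S_def mat_1_eq_mat22)
next
  case (Suc N)
  define s where "s = (\<Prod>t<N. sgn_word n x (int t))"
  define r where "r = rate (x (int N))"
  obtain a b where ab: "\<bar>a\<bar> = exp (S N x)" "\<bar>b\<bar> = exp (- S N x)"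
    "cocycle swapping N x = (if s = 1 then mat22 a 0 0 b else mat22 0 (b / \<kappa>) (\<kappa> * a) 0)"
    using Suc unfolding s_def by blast
  have "\<bar>s\<bar> = 1" unfolding s_def by (rule abs_prod_sgn_word)
  hence s: "s = 1 \<or> s = - 1" by linarith
  have o: "orientation n x N = s * sgn_word n x (int N)"
    unfolding orientation_def s_def by (simp flip: lessThan_Suc_atMost)
  have p: "(\<Prod>t<Suc N. sgn_word n x (int t)) = s * sgn_word n x (int N)"
    by (simp add: s_def)
  have SS: "S (Suc N) x = S N x + s * sgn_word n x (int N) * r" by (simp add: S_def o r_def)
  have sw: "swapping ((shift ^^ N) x) = (if word_at n x (int N) then mat22 0 (- exp r / \<kappa>) (exp (- r) * \<kappa>) 0
     else mat22 (exp r) 0 0 (exp (- r)))"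
    unfolding swapping_def word_at_shift_funpow by (simp add: shift_funpow r_def)
  have \<kappa>0: "\<kappa> \<noteq> 0" using \<kappa> by simp
  consider "s = 1" "word_at n x (int N)" | "s = 1" "\<not> word_at n x (int N)"
    | "s = - 1" "word_at n x (int N)" | "s = - 1" "\<not> word_at n x (int N)"
    using s by blast
  thus ?case
  proof cases
    case 1 thus ?thesis unfolding p SS cocycle.simps sw ab(3)
      by (intro exI[of _ "exp (- r) * a"] exI[of _ "- exp r * b"])
         (simp add: sgn_word_def abs_mult ab(1,2) \<kappa>0 flip: exp_add)
  next
    case 2 thus ?thesis unfolding p SS cocycle.simps sw ab(3)
      by (intro exI[of _ "exp r * a"] exI[of _ "exp (- r) * b"])
         (simp add: sgn_word_def abs_mult ab(1,2) \<kappa>0 flip: exp_add)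
  next
    case 3 thus ?thesis unfolding p SS cocycle.simps sw ab(3)
      by (intro exI[of _ "- exp r * a"] exI[of _ "exp (- r) * b"])
         (simp add: sgn_word_def abs_mult ab(1,2) \<kappa>0 flip: exp_add)
  next
    case 4 thus ?thesis unfolding p SS cocycle.simps sw ab(3)
      by (intro exI[of _ "exp (- r) * a"] exI[of _ "exp r * b"])
         (simp add: sgn_word_def abs_mult ab(1,2) \<kappa>0 flip: exp_add)
  qed
qed

text \<open>The conjugating shears and the factor \<kappa> change the size of the iterates only by a
  bounded factor, so the growth is governed by \<bar>S\<bar>, which is sublinear almost
  surely.\<close>

lemma lyap_perturbed:
  assumes p: "0 < p" "p < 1"
  shows "lyap_plus_is (bernoulli_shift_measure p) perturbed 0"
    "lyap_minus_is (bernoulli_shift_measure p) perturbed 0"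
proof -
  define S where "S N x = (\<Sum>k<N. orientation n x k * rate (x (int k)))" for N x
  \<comment> \<open>The 2 accounts for the unit diagonal of a shear; the sum bounds its slope
    uniformly in x.\<close>
  define G where "G = 2 + (\<Sum>t\<in>{- int n..<int n}. \<bar>slope t\<bar>)"
  have G1: "1 \<le> G" unfolding G_def by (simp add: sum_nonneg add_increasing2)
  have G: "entry_sum (mat22 1 0 (shear x) 1) \<le> G" "entry_sum (mat22 1 0 (- shear x) 1) \<le> G" for x
  proof -
    have "\<bar>shear x\<bar> \<le> (\<Sum>t\<in>{- int n..<int n}. \<bar>slope t\<bar>)"
      unfolding shear_def by (intro order_trans[OF sum_abs] sum_mono) simp
    thus "entry_sum (mat22 1 0 (shear x) 1) \<le> G" "entry_sum (mat22 1 0 (- shear x) 1) \<le> G"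
      by (simp_all add: entry_sum_mat22 G_def)
  qed
  have es_nonneg: "0 \<le> entry_sum A" for A by (simp add: entry_sum_def)
  have sandwich: "entry_sum (P ** A ** Q) \<le> G * entry_sum A * G"
    if "entry_sum P \<le> G" "entry_sum Q \<le> G" for P A Q
    using that G1 es_nonneg
    by (intro order_trans[OF entry_sum_mult] mult_mono order_trans[OF entry_sum_mult]) auto
  have inv: "mat22 1 0 g 1 ** mat22 1 0 (- g) 1 = mat 1" "mat22 1 0 (- g) 1 ** mat22 1 0 g 1 = mat 1" for g
    by (simp_all add: mat_1_eq_mat22)
  have B_M: "cocycle perturbed N x = mat22 1 0 (shear ((shift ^^ N) x)) 1 ** cocycle swapping N x ** mat22 1 0 (- shear x) 1"
    for N x
    unfolding cocycle_perturbed_conjugate[symmetric] by (simp only: matrix_mul_assoc[symmetric] inv matrix_mul_rid)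
  have M_B: "cocycle swapping N x = mat22 1 0 (- shear ((shift ^^ N) x)) 1 ** cocycle perturbed N x ** mat22 1 0 (shear x) 1"
    for N x
    unfolding matrix_mul_assoc[symmetric] cocycle_perturbed_conjugate
    by (simp only: matrix_mul_assoc inv matrix_mul_lid)
  have M: "entry_sum (cocycle swapping N x) \<le> 2 * \<kappa> * exp \<bar>S N x\<bar>"
       "exp \<bar>S N x\<bar> \<le> \<kappa> * entry_sum (cocycle swapping N x)" for N x
  proof -
    obtain a b where ab: "\<bar>a\<bar> = exp (S N x)" "\<bar>b\<bar> = exp (- S N x)"
     "cocycle swapping N x = mat22 a 0 0 b \<or> cocycle swapping N x = mat22 0 (b / \<kappa>) (\<kappa> * a) 0"
      using cocycle_swapping[where N=N and x=x] unfolding S_def by metis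
    have ub: "\<bar>a\<bar> \<le> exp \<bar>S N x\<bar>" "\<bar>b\<bar> \<le> exp \<bar>S N x\<bar>" unfolding ab(1,2) by simp_all
    have lb: "exp \<bar>S N x\<bar> \<le> \<bar>a\<bar> + \<bar>b\<bar>" unfolding ab(1,2) by (cases "0 \<le> S N x") auto
    define a' b' where "a' = \<bar>a\<bar>" and "b' = \<bar>b\<bar>"
    have scale: "t \<le> \<kappa> * t" "t / \<kappa> \<le> t" if "0 \<le> t" for t
      using mult_right_mono[OF \<kappa> that] \<kappa> that by (simp_all add: divide_le_eq mult.commute)
    have nn: "0 \<le> a'" "0 \<le> b'" by (simp_all add: a'_def b'_def)
    have es: "entry_sum (cocycle swapping N x) = a' + b' \<or> entry_sum (cocycle swapping N x) = b' / \<kappa> + \<kappa> * a'"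
      using ab(3) \<kappa> by (auto simp: entry_sum_mat22 a'_def b'_def abs_mult)
    have "a' + b' \<le> \<kappa> * (a' + b')" "b' / \<kappa> + \<kappa> * a' \<le> \<kappa> * (a' + b')"
      using scale[of "a' + b'"] scale[OF nn(2)] nn by (simp_all add: distrib_left)
    hence "entry_sum (cocycle swapping N x) \<le> \<kappa> * (a' + b')" using es by auto
    also have "\<dots> \<le> \<kappa> * (2 * exp \<bar>S N x\<bar>)"
      using ub \<kappa> by (intro mult_left_mono) (auto simp: a'_def b'_def)
    finally show "entry_sum (cocycle swapping N x) \<le> 2 * \<kappa> * exp \<bar>S N x\<bar>" by simp
    have "a' + b' \<le> \<kappa> * (b' / \<kappa> + \<kappa> * a')"
    proof -
      have "a' \<le> \<kappa> * a'" using nn(1) by (rule scale)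
      also have "\<dots> \<le> \<kappa> * (\<kappa> * a')" using nn(1) \<kappa> by (intro scale) simp
      finally show ?thesis using \<kappa> by (simp add: distrib_left)
    qed
    moreover have "a' + b' \<le> \<kappa> * (a' + b')" using nn by (intro scale) simp
    ultimately have "a' + b' \<le> \<kappa> * entry_sum (cocycle swapping N x)" using es by auto
    thus "exp \<bar>S N x\<bar> \<le> \<kappa> * entry_sum (cocycle swapping N x)" using lb by (simp add: a'_def b'_def)
  qed
  have "entry_sum (cocycle perturbed N x) \<le> (2 * \<kappa> * G\<^sup>2) * exp \<bar>S N x\<bar>" for N x
  proof -
    have "entry_sum (cocycle perturbed N x) \<le> G * entry_sum (cocycle swapping N x) * G"
      unfolding B_M by (intro sandwich G)
    also have "\<dots> \<le> G * (2 * \<kappa> * exp \<bar>S N x\<bar>) * G"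
      using G1 by (intro mult_right_mono mult_left_mono M) auto
    finally show ?thesis by (simp add: power2_eq_square mult_ac)
  qed
  moreover have "exp \<bar>S N x\<bar> \<le> (2 * \<kappa> * G\<^sup>2) * entry_sum (cocycle perturbed N x)" for N x
  proof -
    have "exp \<bar>S N x\<bar> \<le> \<kappa> * entry_sum (cocycle swapping N x)" by (rule M)
    also have "\<dots> \<le> \<kappa> * (G * entry_sum (cocycle perturbed N x) * G)"
      unfolding M_B using \<kappa> by (intro mult_left_mono sandwich G) auto
    also have "\<dots> = 1 * (\<kappa> * G\<^sup>2 * entry_sum (cocycle perturbed N x))"
      by (simp add: power2_eq_square mult_ac)
    also have "\<dots> \<le> 2 * (\<kappa> * G\<^sup>2 * entry_sum (cocycle perturbed N x))"
      using \<kappa> es_nonneg by (intro mult_right_mono) auto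
    finally show ?thesis by (simp add: mult.assoc)
  qed
  moreover have "0 < 2 * \<kappa> * G\<^sup>2" using \<kappa> G1 by simp
  moreover have "AE x in bernoulli_shift_measure p. (\<lambda>N. S N x / real N) \<longlonglongrightarrow> 0"
    unfolding S_def by (rule orientation_sum_sublinear[OF p n])
  ultimately show "lyap_plus_is (bernoulli_shift_measure p) perturbed 0"
      "lyap_minus_is (bernoulli_shift_measure p) perturbed 0"
    using lyap_of_growth[where A=perturbed and K="2 * \<kappa> * G\<^sup>2" and S=S and L=0, OF det_perturbed] by simp_all
qed

section \<open>Hoelder size of the perturbation\<close>

lemma rate_bounds: "exp (rate b) \<le> \<sigma>" "exp (- rate b) \<le> \<eta>"
  using \<eta> \<sigma> le_imp_inverse_le[of 1 \<eta>] le_imp_inverse_le[of 1 \<sigma>]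
  by (auto simp: log_rate_def exp_minus)

lemma abs_kick_le: "\<bar>kick x\<bar> \<le> 2 * \<kappa> * \<eta> powr (- 2 * real n)"
proof -
  have "\<sigma> powr (- 2 * real n) \<le> \<eta> powr (- 2 * real n)"
    using \<eta> \<sigma> by (intro powr_mono2') auto
  hence "\<bar>slope (- int n)\<bar> \<le> \<kappa> * \<eta> powr (- 2 * real n)" "\<bar>slope (int n)\<bar> \<le> \<kappa> * \<eta> powr (- 2 * real n)"
    using n \<kappa> by (simp_all add: slope_def abs_mult)
  thus ?thesis unfolding kick_def by (auto split: if_splits)
qed

context
  fixes \<alpha> :: real
  assumes \<alpha>: "0 < \<alpha>"
begin

lemma abs_upper_entry_le: "\<bar>if word_at n x 0 then - exp (rate (x 0)) / \<kappa> else 0\<bar> \<le> \<sigma> / \<kappa>"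
  using rate_bounds(1)[of "x 0"] \<kappa> \<eta> \<sigma> by (auto intro!: divide_right_mono)

lemma abs_lower_entry_le: "\<bar>exp (- rate (x 0)) * kick x\<bar> \<le> \<sigma> * (2 * \<kappa> * \<eta> powr (- 2 * real n))"
  unfolding abs_mult using rate_bounds(2)[of "x 0"] \<eta> \<sigma>
  by (intro mult_mono abs_kick_le) auto

lemma upper_entry_holder:
  "\<bar>(if word_at n x 0 then - exp (rate (x 0)) / \<kappa> else 0) - (if word_at n y 0 then - exp (rate (y 0)) / \<kappa> else 0)\<bar>
    \<le> 2 * (\<sigma> / \<kappa>) * 2 powr (\<alpha> * real n) * shift_dist x y powr \<alpha>"
proof (rule local_function_holder[OF \<alpha> abs_upper_entry_le])
  fix x y :: seq assume eq: "\<And>k. \<bar>k\<bar> \<le> int n \<Longrightarrow> x k = y k"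
  have "word_at n x 0 = word_at n y 0" by (rule word_at_cong) (auto intro!: eq)
  thus "(if word_at n x 0 then - exp (rate (x 0)) / \<kappa> else 0) = (if word_at n y 0 then - exp (rate (y 0)) / \<kappa> else 0)"
    using eq[of 0] by simp
qed

text \<open>Words beginning at 0 or ending at -1 extend to distance 2n, which doubles the exponent
  of 2 compared with the upper entry; the factor \<open>\<eta> powr (- 2 * real n)\<close> has to
  pay for it.\<close>

lemma lower_entry_holder:
  "\<bar>exp (- rate (x 0)) * kick x - exp (- rate (y 0)) * kick y\<bar>
    \<le> 2 * (\<sigma> * (2 * \<kappa> * \<eta> powr (- 2 * real n))) * 2 powr (\<alpha> * real (2 * n)) * shift_dist x y powr \<alpha>"
proof (rule local_function_holder[OF \<alpha> abs_lower_entry_le])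
  fix x y :: seq assume eq: "\<And>k. \<bar>k\<bar> \<le> int (2 * n) \<Longrightarrow> x k = y k"
  have "word_at n x (int n) = word_at n y (int n)" "word_at n x (- int n) = word_at n y (- int n)"
    by (rule word_at_cong; auto intro!: eq)+
  thus "exp (- rate (x 0)) * kick x = exp (- rate (y 0)) * kick y"
    using eq[of 0] by (simp add: kick_def)
qed

lemma holder_map_perturbed: "holder_map \<alpha> perturbed"
proof -
  have diag: "\<bar>F (x 0) - F (y 0)\<bar> \<le> 2 * max \<bar>F True\<bar> \<bar>F False\<bar> * 2 powr (\<alpha> * real 0) * shift_dist x y powr \<alpha>"
    for F :: "bool \<Rightarrow> real" and x y :: seq
  proof (rule local_function_holder[OF \<alpha>, where F="\<lambda>x. F (x 0)"])
    show "\<bar>F (x 0)\<bar> \<le> max \<bar>F True\<bar> \<bar>F False\<bar>" for x :: seq by (cases "x 0") auto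
  qed auto
  show ?thesis
    unfolding perturbed_def
    by (rule holder_map_mat22[OF diag[where F="\<lambda>b. exp (rate b)"] upper_entry_holder lower_entry_holder diag[where F="\<lambda>b. exp (- rate b)"]])
qed

lemma holder_norm_perturbation_le:
  "holder_norm \<alpha> (\<lambda>x. perturbed x - A_sigma_eta \<sigma> \<eta> x)
    \<le> 3 * (\<sigma> / \<kappa>) * 2 powr (\<alpha> * real n) + 6 * \<sigma> * \<kappa> * \<eta> powr (- 2 * real n) * 2 powr (\<alpha> * real (2 * n))"
proof -
  have "(\<lambda>x. perturbed x - A_sigma_eta \<sigma> \<eta> x)
    = (\<lambda>x. mat22 0 (if word_at n x 0 then - exp (rate (x 0)) / \<kappa> else 0) (exp (- rate (x 0)) * kick x) 0)"
    using \<eta> \<sigma> by (simp add: perturbed_def A_sigma_eta_eq_mat22 mat22_diff fun_eq_iff)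
  hence "holder_norm \<alpha> (\<lambda>x. perturbed x - A_sigma_eta \<sigma> \<eta> x)
    \<le> (\<sigma> / \<kappa> + \<sigma> * (2 * \<kappa> * \<eta> powr (- 2 * real n)))
      + (2 * (\<sigma> / \<kappa>) * 2 powr (\<alpha> * real n) + 2 * (\<sigma> * (2 * \<kappa> * \<eta> powr (- 2 * real n))) * 2 powr (\<alpha> * real (2 * n)))"
    using holder_norm_antidiagonal_le[OF abs_upper_entry_le abs_lower_entry_le upper_entry_holder lower_entry_holder]
    by simp
  \<comment> \<open>Absorbs the sup-norm parts into the Hoelder parts, giving the constants 1 + 2 =
    3 and 2 + 4 = 6.\<close>
  moreover have "u * 1 \<le> u * 2 powr (\<alpha> * real m)" if "0 \<le> u" for u m
    using that \<alpha> by (intro mult_left_mono ge_one_powr_ge_zero) auto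
  from this[of "\<sigma> / \<kappa>" n] this[of "\<sigma> * (2 * \<kappa> * \<eta> powr (- 2 * real n))" "2 * n"]
  have "\<sigma> / \<kappa> \<le> \<sigma> / \<kappa> * 2 powr (\<alpha> * real n)"
    "\<sigma> * (2 * \<kappa> * \<eta> powr (- 2 * real n)) \<le> \<sigma> * (2 * \<kappa> * \<eta> powr (- 2 * real n)) * 2 powr (\<alpha> * real (2 * n))"
    using \<kappa> \<eta> \<sigma> by simp_all
  ultimately show ?thesis by linarith
qed

end

end

text \<open>One term of the norm bound decreases in \<kappa>, the other increases. Taking \<kappa> =
  2^(\<alpha> n) / \<delta> turns the first into 3 \<sigma> \<delta> and the second into a multiple
  of r^n, where r < 1 is the pinching hypothesis.\<close>

lemma exists_small_perturbation:
  fixes p \<alpha> \<eta> \<sigma> \<epsilon> :: real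
  assumes p: "0 < p" "p < 1" and \<alpha>: "0 < \<alpha>" and \<eta>: "1 < \<eta>" and \<sigma>: "\<eta> < \<sigma>"
    and pinch: "2 powr (3 * \<alpha>) < \<eta>\<^sup>2" and \<epsilon>: "0 < \<epsilon>"
  shows "\<exists>B. (\<forall>x. is_SL2 (B x)) \<and> holder_map \<alpha> B
            \<and> holder_norm \<alpha> (\<lambda>x. B x - A_sigma_eta \<sigma> \<eta> x) < \<epsilon>
            \<and> lyap_plus_is (bernoulli_shift_measure p) B 0
            \<and> lyap_minus_is (bernoulli_shift_measure p) B 0"
proof -
  \<comment> \<open>The bound 1 ensures \<kappa> \<ge> 1; the other makes the first term at most
    \<epsilon>/4. It is fixed before n, so the constant 6 \<sigma> / \<delta> does not grow with
    n.\<close>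
  define \<delta> where "\<delta> = min 1 (\<epsilon> / (12 * \<sigma>))"
  have \<sigma>0: "0 < \<sigma>" using \<eta> \<sigma> by simp
  have \<delta>: "0 < \<delta>" "\<delta> \<le> 1" "3 * \<sigma> * \<delta> \<le> \<epsilon> / 4"
    using \<epsilon> \<sigma>0 by (auto simp: \<delta>_def min_def field_simps)
  define r where "r = 2 powr (3 * \<alpha>) / \<eta>\<^sup>2"
  have r: "0 < r" "r < 1" using pinch \<eta> by (auto simp: r_def)
  have "(\<lambda>n. 6 * \<sigma> / \<delta> * r ^ n) \<longlonglongrightarrow> 6 * \<sigma> / \<delta> * 0"
    using r by (intro tendsto_intros LIMSEQ_realpow_zero) auto
  hence "\<forall>\<^sub>F n in sequentially. 6 * \<sigma> / \<delta> * r ^ n < \<epsilon> / 2"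
    using \<epsilon> by (intro order_tendstoD(2)) auto
  with eventually_ge_at_top[of 2] have "\<forall>\<^sub>F n in sequentially. 2 \<le> n \<and> 6 * \<sigma> / \<delta> * r ^ n < \<epsilon> / 2"
    by eventually_elim simp
  then obtain n :: nat where n: "2 \<le> n" and small: "6 * \<sigma> / \<delta> * r ^ n < \<epsilon> / 2"
    using eventually_happens'[OF sequentially_bot] by blast
  define \<kappa> where "\<kappa> = 2 powr (\<alpha> * real n) / \<delta>"
  have \<kappa>: "1 \<le> \<kappa>"
  proof -
    have "1 \<le> 2 powr (\<alpha> * real n)" using \<alpha> by (intro ge_one_powr_ge_zero) auto
    thus ?thesis using \<delta> by (simp add: \<kappa>_def le_divide_eq)
  qed
  let ?B = "perturbed n \<kappa> \<eta> \<sigma>"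
  have "holder_norm \<alpha> (\<lambda>x. ?B x - A_sigma_eta \<sigma> \<eta> x)
    \<le> 3 * (\<sigma> / \<kappa>) * 2 powr (\<alpha> * real n) + 6 * \<sigma> * \<kappa> * \<eta> powr (- 2 * real n) * 2 powr (\<alpha> * real (2 * n))"
    by (rule holder_norm_perturbation_le[OF n \<kappa> \<eta> \<sigma> \<alpha>])
  also have "3 * (\<sigma> / \<kappa>) * 2 powr (\<alpha> * real n) = 3 * \<sigma> * \<delta>"
    using \<delta> by (simp add: \<kappa>_def)
  also have "6 * \<sigma> * \<kappa> * \<eta> powr (- 2 * real n) * 2 powr (\<alpha> * real (2 * n)) = 6 * \<sigma> / \<delta> * r ^ n"
  proof -
    have "r ^ n = 2 powr (3 * \<alpha> * real n) / \<eta> powr (2 * real n)"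
    proof -
      have "(\<eta>\<^sup>2) ^ n = \<eta> powr real (2 * n)"
        using \<eta> by (simp only: powr_realpow power_mult)
      moreover have "(2 powr (3 * \<alpha>)) ^ n = 2 powr (3 * \<alpha> * real n)"
        by (simp only: powr_realpow[symmetric] powr_powr powr_gt_zero zero_neq_numeral[symmetric] simp_thms)
      ultimately show ?thesis by (simp only: r_def power_divide of_nat_mult of_nat_numeral)
    qed
    also have "\<dots> = 2 powr (\<alpha> * real n) * 2 powr (\<alpha> * real (2 * n)) * \<eta> powr (- 2 * real n)"
    proof -
      have "\<alpha> * real n + \<alpha> * real (2 * n) = 3 * \<alpha> * real n" by simp
      thus ?thesis by (simp only: powr_minus_divide mult_minus_left flip: powr_add) simp
    qed
    finally show ?thesis by (simp add: \<kappa>_def)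
  qed
  finally have "holder_norm \<alpha> (\<lambda>x. ?B x - A_sigma_eta \<sigma> \<eta> x) < \<epsilon>"
    using \<delta>(3) small \<epsilon> by linarith
  thus ?thesis
    using det_perturbed[OF n \<kappa> \<eta> \<sigma>] holder_map_perturbed[OF n \<kappa> \<eta> \<sigma> \<alpha>] lyap_perturbed[OF n \<kappa> \<eta> \<sigma> p]
    by (auto simp: is_SL2_def)
qed

theorem theoremA:
  fixes p \<alpha> \<eta> \<sigma> :: real
  assumes "0 < p" "p < 1" "0 < \<alpha>" "1 < \<eta>" "\<eta> < \<sigma>"
    and "2 powr (3 * \<alpha>) < \<eta>\<^sup>2"
    and "p / (1 - p) \<noteq> ln \<eta> / ln \<sigma>"
  shows "(\<forall>\<epsilon>>0. \<exists>B. (\<forall>x. is_SL2 (B x)) \<and> holder_map \<alpha> B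
            \<and> holder_norm \<alpha> (\<lambda>x. B x - A_sigma_eta \<sigma> \<eta> x) < \<epsilon>
            \<and> lyap_plus_is (bernoulli_shift_measure p) B 0
            \<and> lyap_minus_is (bernoulli_shift_measure p) B 0)
       \<and> lyap_plus_is (bernoulli_shift_measure p) (A_sigma_eta \<sigma> \<eta>)
            \<bar>(1 - p) * ln \<eta> - p * ln \<sigma>\<bar>
       \<and> lyap_minus_is (bernoulli_shift_measure p) (A_sigma_eta \<sigma> \<eta>)
            (- \<bar>(1 - p) * ln \<eta> - p * ln \<sigma>\<bar>)
       \<and> \<bar>(1 - p) * ln \<eta> - p * ln \<sigma>\<bar> \<noteq> 0"
proof (intro conjI allI impI)
  \<comment> \<open>With 1 - p > 0 this allows the ratio hypothesis to be cross-multiplied into the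
    nonvanishing of the unperturbed exponent.\<close>
  have "0 < ln \<sigma>" using assms(4,5) by simp
  with assms(2,7) show "\<bar>(1 - p) * ln \<eta> - p * ln \<sigma>\<bar> \<noteq> 0"
    by (auto simp: field_simps)
qed (use assms in \<open>auto intro!: exists_small_perturbation lyap_A_sigma_eta\<close>)

end
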